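(* Let $G$ be a graph, let $V(G)=V_1\cup V_2$ be a partition of its vertex set with $V_2\neq\emptyset$, and let $X\subseteq V_1$ be the vertex boundary of $V_2$ in $G$. Let $H$ be a connected graph with $|H|\ge|V_2|$ and let $G':=(G[V_1],X)\vee H$. Suppose there is $M\in S(G)$ such that $M[V_2]$ has distinct eigenvalues $\lambda_1,\dots,\lambda_{|V_2|}$. Let $t=|H|-|V_2|$ and let $\mu_1,\dots,\mu_t$ be any distinct real numbers with $\mu_i\neq\lambda_j$ for all $i\in[t]$, $j\in[|V_2|]$. Then there exists $N\in S(G')$ with spectrum $\sigma(N)=\sigma(M)\cup\{\mu_1,\dots,\mu_t\}$ (union of multisets).
   Context: $S(G)$ is the set of real symmetric matrices indexed by $V(G)$ whose $(i,j)$ off-diagonal entry is nonzero iff $\{i,j\}\in E(G)$ (diagonal unrestricted). $G[W]$ is the induced subgraph and $M[W]$ the principal submatrix on $W$; $\sigma(\cdot)$ is the spectrum as a multiset. The vertex boundary of $W\subseteq V(G)$ is the set of vertices outside $W$ adjacent to some vertex of $W$. For disjoint graphs $G_1,G_2$ and $U_1\subseteq V(G_1)$, the partial join $(G_1,U_1)\vee G_2$ is $G_1\cup G_2$ together with all edges joining each vertex of $U_1$ to each vertex of $G_2$. *)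

theory Defs
  imports "HOL-Combinatorics.Permutations" "HOL-Computational_Algebra.Polynomial"
begin

text \<open>A finite simple graph: a finite vertex set V and a set E of 2-element subsets of V.\<close>
definition sgraph :: "'a set \<Rightarrow> 'a set set \<Rightarrow> bool" where
  "sgraph V E \<longleftrightarrow> finite V \<and> (\<forall>e\<in>E. \<exists>u v. u \<noteq> v \<and> u \<in> V \<and> v \<in> V \<and> e = {u, v})"

definition connected_graph :: "'a set \<Rightarrow> 'a set set \<Rightarrow> bool" where
  "connected_graph V E \<longleftrightarrow> V \<noteq> {} \<and>
     (\<forall>u\<in>V. \<forall>v\<in>V. (u, v) \<in> {(x, y). {x, y} \<in> E}\<^sup>*)"

text \<open>Edge set of the induced subgraph G[W].\<close>
definition induced_edges :: "'a set set \<Rightarrow> 'a set \<Rightarrow> 'a set set" where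
  "induced_edges E W = {e \<in> E. e \<subseteq> W}"

text \<open>Vertex boundary of W in G.\<close>
definition vertex_boundary :: "'a set \<Rightarrow> 'a set set \<Rightarrow> 'a set \<Rightarrow> 'a set" where
  "vertex_boundary V E W = {v \<in> V - W. \<exists>w\<in>W. {v, w} \<in> E}"

text \<open>Partial join (G1,U1) v G2, realised on the disjoint union type 'a + 'b.\<close>
definition pjoin_vertices :: "'a set \<Rightarrow> 'b set \<Rightarrow> ('a + 'b) set" where
  "pjoin_vertices V1 V2 = Inl ` V1 \<union> Inr ` V2"

definition pjoin_edges :: "'a set set \<Rightarrow> 'a set \<Rightarrow> 'b set \<Rightarrow> 'b set set \<Rightarrow> ('a + 'b) set set" where
  "pjoin_edges E1 U1 V2 E2 =
     (image Inl) ` E1 \<union> (image Inr) ` E2 \<union> {{Inl u, Inr w} | u w. u \<in> U1 \<and> w \<in> V2}"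

text \<open>S(G): real symmetric matrices indexed by V (entries outside V irrelevant) whose
  off-diagonal (i,j) entry is nonzero iff ij is an edge.\<close>
definition S_graph :: "'a set \<Rightarrow> 'a set set \<Rightarrow> ('a \<Rightarrow> 'a \<Rightarrow> real) set" where
  "S_graph V E = {M. (\<forall>i\<in>V. \<forall>j\<in>V. M i j = M j i) \<and>
      (\<forall>i\<in>V. \<forall>j\<in>V. i \<noteq> j \<longrightarrow> (M i j \<noteq> 0 \<longleftrightarrow> {i, j} \<in> E))}"

text \<open>Determinant of the matrix indexed by the finite set V (Leibniz formula).\<close>
definition det_on :: "'a set \<Rightarrow> ('a \<Rightarrow> 'a \<Rightarrow> 'b::comm_ring_1) \<Rightarrow> 'b" where
  "det_on V A = (\<Sum>p\<in>{p. p permutes V}. of_int (sign p) * (\<Prod>i\<in>V. A i (p i)))"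

text \<open>Characteristic polynomial det(xI - M[V]) of the principal submatrix on V.\<close>
definition charpoly_on :: "'a set \<Rightarrow> ('a \<Rightarrow> 'a \<Rightarrow> real) \<Rightarrow> real poly" where
  "charpoly_on V M = det_on V (\<lambda>i j. (if i = j then [:0, 1:] else 0) - [:M i j:])"

text \<open>Spectrum (multiset of eigenvalues) of the principal submatrix M[V].\<close>
definition spectrum_on :: "'a set \<Rightarrow> ('a \<Rightarrow> 'a \<Rightarrow> real) \<Rightarrow> real multiset" where
  "spectrum_on V M = proots (charpoly_on V M)"

end

theory Submission
  imports Defs "Jordan_Normal_Form.Char_Poly"
begin

text \<open>Diagonalise \<open>M[V2]\<close> by an orthogonal \<open>Q\<close>; then \<open>M\<close> is similar to the matrix with blocks \<open>M[V1]\<close>,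
  \<open>C = M[V1,V2] Q\<close>, \<open>C\<^sup>T\<close> and the diagonal matrix of the \<open>\<lambda>\<^sub>i\<close>. Padding \<open>C\<close> by zero columns, adding
  the \<open>\<mu>\<^sub>i\<close> to the diagonal and conjugating the second block by an orthogonal \<open>P\<close> indexed by \<open>H\<close> gives a
  matrix with the required spectrum. It has the right pattern if the diagonal matrix conjugated
  by \<open>P\<close> lies in \<open>S(H)\<close> and no coordinate of \<open>P c\<close> vanishes for the nonzero rows \<open>c\<close> of the padded \<open>C\<close>, which are
  those belonging to \<open>X\<close>.

  To find \<open>P\<close>, note that every small symmetric off-diagonal pattern is realised by a matrix
  with the prescribed simple spectrum whose eigenvectors depend continuously on the pattern
  (a contraction argument). Start with the diagonal matrix and attach the vertices of \<open>H\<close> one at a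
  time by a pendant edge of tiny weight \<open>\<epsilon>\<close>. Coordinates that are already nonzero stay nonzero; a
  new one is \<open>\<epsilon>\<close> times an expression whose limit is a coordinate of \<open>P c'\<close> for another vector \<open>c'\<close>, or a
  resolvent entry of the previous matrix, both nonzero by the induction hypothesis. The
  remaining edges are added with tiny weight at the end.\<close>

section \<open>Determinants over finite index sets\<close>

lemma det_on_cong:
  assumes "\<And>i j. i \<in> V \<Longrightarrow> j \<in> V \<Longrightarrow> A i j = B i j"
  shows "det_on V A = det_on V B"
  unfolding det_on_def
  using assms
  by (intro sum.cong refl arg_cong2[where f = "(*)"] prod.cong) (auto simp: permutes_in_image)

text \<open>Conjugation by \<open>f\<close> carries the permutations of \<open>V\<close> bijectively
  to those of \<open>W\<close> and preserves signs, so the two Leibniz sums agree term by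
  term.\<close>

lemma det_on_reindex:
  assumes f: "bij_betw f V W" and V: "finite V"
  shows "det_on W A = det_on V (\<lambda>i j. A (f i) (f j))"
proof -
  define F where "F = (\<lambda>p x. if x \<in> W then f (p (inv_into V f x)) else x)"
  have bij: "bij_betw F {p. p permutes V} {p. p permutes W}"
    unfolding F_def by (rule bij_betw_permutations[OF f])
  have inj: "inj_on f V" and im: "f ` V = W"
    using f by (auto simp: bij_betw_def)
  have F: "F p = map_permutation V f p" if "p permutes V" for p
    using that im by (auto simp: F_def map_permutation_def restrict_id_def fun_eq_iff)
  have "det_on W A = (\<Sum>p | p permutes V. of_int (sign (F p)) * (\<Prod>i\<in>W. A i (F p i)))"
    unfolding det_on_def by (rule sum.reindex_bij_betw[OF bij, symmetric])
  also have "\<dots> = (\<Sum>p | p permutes V. of_int (sign p) * (\<Prod>i\<in>V. A (f i) (f (p i))))"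
  proof (rule sum.cong[OF refl])
    fix p assume "p \<in> {p. p permutes V}"
    then have p: "p permutes V" by simp
    have "(\<Prod>i\<in>W. A i (F p i)) = (\<Prod>i\<in>V. A (f i) (F p (f i)))"
      by (rule prod.reindex_bij_betw[OF f, symmetric])
    also have "\<dots> = (\<Prod>i\<in>V. A (f i) (f (p i)))"
      using im by (intro prod.cong) (auto simp: F_def inv_into_f_f[OF inj])
    finally show "of_int (sign (F p)) * (\<Prod>i\<in>W. A i (F p i))
        = of_int (sign p) * (\<Prod>i\<in>V. A (f i) (f (p i)))"
      using sign_map_permutation[OF inj p V] F[OF p] by simp
  qed
  finally show ?thesis unfolding det_on_def .
qed

text \<open>An enumeration of \<open>V\<close> makes the determinant theory of number-indexed
  matrices applicable.\<close>

lemma det_on_eq_det: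
  assumes "bij_betw f {0..<n} V"
  shows "det_on V A = det (mat n n (\<lambda>(i, j). A (f i) (f j)))"
proof -
  have "(\<Prod>i=0..<n. A (f i) (f (p i))) = (\<Prod>i=0..<n. mat n n (\<lambda>(i, j). A (f i) (f j)) $$ (i, p i))"
    if "p permutes {0..<n}" for p
    using permutes_in_image[OF that] by (intro prod.cong) auto
  then show ?thesis
    unfolding det_on_reindex[OF assms finite_atLeastLessThan]
    by (auto simp: det_def det_on_def intro!: sum.cong)
qed

lemma det_on_one:
  assumes "finite V"
  shows "det_on V (\<lambda>i j. if i = j then 1 else 0) = (1::'b::comm_ring_1)"
proof -
  from assms obtain f where f: "bij_betw f {0..<card V} V"
    using ex_bij_betw_nat_finite by blast
  have "mat (card V) (card V) (\<lambda>(i, j). if f i = f j then 1 else 0) = (1\<^sub>m (card V) :: 'b mat)"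
    using f by (auto simp: bij_betw_def inj_on_def intro!: eq_matI)
  then show ?thesis
    unfolding det_on_eq_det[OF f] by simp
qed

lemma mat_mult_reindex:
  assumes "bij_betw f {0..<n} V"
  shows "mat n n (\<lambda>(i, j). A (f i) (f j)) * mat n n (\<lambda>(i, j). B (f i) (f j))
     = mat n n (\<lambda>(i, j). \<Sum>k\<in>V. A (f i) k * B k (f j))"
  by (rule eq_matI)
    (auto simp: scalar_prod_def sum.reindex_bij_betw[OF assms, symmetric])

lemma det_on_mult:
  assumes "finite V"
  shows "det_on V (\<lambda>i j. \<Sum>k\<in>V. A i k * B k j) = det_on V A * det_on V B"
proof -
  obtain f where f: "bij_betw f {0..<card V} V"
    using ex_bij_betw_nat_finite[OF assms] by blast
  show ?thesis
    unfolding det_on_eq_det[OF f]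
    by (subst det_mult[symmetric, of _ "card V"])
      (simp_all add: mat_mult_reindex[OF f])
qed

text \<open>For square matrices a one-sided inverse is two-sided. This later turns orthonormal
  columns into orthonormal rows.\<close>

lemma left_right_inverse_on:
  fixes A B :: "'a \<Rightarrow> 'a \<Rightarrow> 'b::field"
  assumes "finite V"
    and AB: "\<And>i j. i \<in> V \<Longrightarrow> j \<in> V \<Longrightarrow> (\<Sum>k\<in>V. A i k * B k j) = (if i = j then 1 else 0)"
    and "i \<in> V" "j \<in> V"
  shows "(\<Sum>k\<in>V. B i k * A k j) = (if i = j then 1 else 0)"
proof -
  obtain f where f: "bij_betw f {0..<card V} V"
    using ex_bij_betw_nat_finite[OF assms(1)] by blast
  let ?n = "card V"
  let ?m = "\<lambda>A. mat ?n ?n (\<lambda>(i, j). A (f i) (f j))"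
  have fV: "f k \<in> V" if "k < ?n" for k
    using f that by (auto simp: bij_betw_def)
  have inj: "f k = f l \<longleftrightarrow> k = l" if "k < ?n" "l < ?n" for k l
    using f that by (auto simp: bij_betw_def inj_on_def)
  have AB': "?m A * ?m B = 1\<^sub>m ?n"
    unfolding mat_mult_reindex[OF f] by (rule eq_matI) (auto simp: AB fV inj)
  have BA: "?m B * ?m A = 1\<^sub>m ?n"
    by (rule mat_mult_left_right_inverse[OF mat_carrier mat_carrier AB'])
  have "i \<in> f ` {0..<?n}" "j \<in> f ` {0..<?n}"
    using f assms(3,4) by (simp_all add: bij_betw_imp_surj_on)
  then obtain k l where kl: "k < ?n" "i = f k" "l < ?n" "j = f l"
    by auto
  have "(?m B * ?m A) $$ (k, l) = (\<Sum>k\<in>V. B i k * A k j)"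
    unfolding mat_mult_reindex[OF f] using kl by simp
  then show ?thesis
    using kl inj by (simp add: BA)
qed

lemma det_on_block:
  fixes A :: "'a \<Rightarrow> 'a \<Rightarrow> 'b::idom"
  assumes "finite U" "finite W" "U \<inter> W = {}"
    and zero: "\<And>i j. i \<in> U \<Longrightarrow> j \<in> W \<Longrightarrow> A i j = 0"
  shows "det_on (U \<union> W) A = det_on U A * det_on W A"
proof -
  let ?n = "card U" and ?m = "card W"
  obtain f g where f: "bij_betw f {0..<?n} U" and g: "bij_betw g {0..<?m} W"
    using ex_bij_betw_nat_finite assms(1,2) by meson
  \<comment> \<open>Listing \<open>U\<close> before \<open>W\<close> produces a block matrix whose
    upper right block is zero.\<close>
  define h where "h i = (if i < ?n then f i else g (i - ?n))" for i
  have sh: "bij_betw (\<lambda>i. i - ?n) {?n..<?n + ?m} {0..<?m}"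
    by (rule bij_betw_byWitness[where f' = "\<lambda>i. i + ?n"]) auto
  have "bij_betw h {?n..<?n + ?m} W"
    using bij_betw_trans[OF sh g] bij_betw_cong[of "{?n..<?n + ?m}" "g \<circ> (\<lambda>i. i - ?n)" h W]
    by (auto simp: h_def)
  moreover have "bij_betw h {0..<?n} U"
    using f bij_betw_cong[of "{0..<?n}" f h U] by (auto simp: h_def)
  ultimately have "bij_betw h ({0..<?n} \<union> {?n..<?n + ?m}) (U \<union> W)"
    using assms(3) by (intro bij_betw_combine)
  moreover have "{0..<?n} \<union> {?n..<?n + ?m} = {0..<?n + ?m}" by auto
  ultimately have h: "bij_betw h {0..<?n + ?m} (U \<union> W)" by simp
  let ?C = "mat ?m ?n (\<lambda>(i, j). A (g i) (f j))"
  have fU: "f k \<in> U" if "k < ?n" for k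
    using f that by (auto simp: bij_betw_def)
  have gW: "g k \<in> W" if "k < ?m" for k
    using g that by (auto simp: bij_betw_def)
  have "mat (?n + ?m) (?n + ?m) (\<lambda>(i, j). A (h i) (h j))
     = four_block_mat (mat ?n ?n (\<lambda>(i, j). A (f i) (f j))) (0\<^sub>m ?n ?m) ?C
         (mat ?m ?m (\<lambda>(i, j). A (g i) (g j)))"
    by (rule eq_matI) (auto simp: h_def zero fU gW)
  then show ?thesis
    unfolding det_on_eq_det[OF h] det_on_eq_det[OF f] det_on_eq_det[OF g]
    by (simp add: det_four_block_mat_upper_right_zero[where n = ?n and m = ?m])
qed

section \<open>Characteristic polynomials of principal submatrices\<close>

lemma charpoly_on_eq_char_poly:
  assumes "bij_betw f {0..<n} V"
  shows "charpoly_on V M = char_poly (mat n n (\<lambda>(i, j). M (f i) (f j)))"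
proof -
  have inj: "f k = f l \<longleftrightarrow> k = l" if "k < n" "l < n" for k l
    using assms that by (auto simp: bij_betw_def inj_on_def)
  show ?thesis
    unfolding charpoly_on_def det_on_eq_det[OF assms] char_poly_def char_poly_matrix_def
    by (rule arg_cong[of _ _ det], rule eq_matI) (auto simp: inj)
qed

lemma charpoly_on_cong:
  assumes "\<And>i j. i \<in> V \<Longrightarrow> j \<in> V \<Longrightarrow> A i j = B i j"
  shows "charpoly_on V A = charpoly_on V B"
  unfolding charpoly_on_def by (rule det_on_cong) (simp add: assms)

lemma charpoly_on_reindex:
  assumes f: "bij_betw f V W" and V: "finite V"
  shows "charpoly_on W M = charpoly_on V (\<lambda>i j. M (f i) (f j))"
proof -
  have "f i = f j \<longleftrightarrow> i = j" if "i \<in> V" "j \<in> V" for i j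
    using f that by (auto simp: bij_betw_def inj_on_def)
  then show ?thesis
    unfolding charpoly_on_def det_on_reindex[OF assms]
    by (intro det_on_cong) auto
qed

lemma charpoly_on_nonzero:
  assumes "finite V"
  shows "charpoly_on V M \<noteq> 0"
proof -
  obtain f where f: "bij_betw f {0..<card V} V"
    using ex_bij_betw_nat_finite[OF assms] by blast
  show ?thesis
    unfolding charpoly_on_eq_char_poly[OF f]
    using degree_monic_char_poly[of "mat (card V) (card V) (\<lambda>(i, j). M (f i) (f j))" "card V"]
    by auto
qed

lemma charpoly_on_block:
  assumes "finite U" "finite W" "U \<inter> W = {}"
    and "\<And>i j. i \<in> U \<Longrightarrow> j \<in> W \<Longrightarrow> M i j = 0"
  shows "charpoly_on (U \<union> W) M = charpoly_on U M * charpoly_on W M"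
  unfolding charpoly_on_def using assms by (intro det_on_block) auto

lemma charpoly_on_diag:
  assumes "finite V"
  shows "charpoly_on V (\<lambda>i j. if i = j then l i else 0) = (\<Prod>i\<in>V. [:- l i, 1:])"
  using assms
proof (induction V rule: finite_induct)
  case empty
  then show ?case by (simp add: charpoly_on_def det_on_def)
next
  case (insert x V)
  have "charpoly_on ({x} \<union> V) (\<lambda>i j. if i = j then l i else 0)
      = charpoly_on {x} (\<lambda>i j. if i = j then l i else 0) * (\<Prod>i\<in>V. [:- l i, 1:])"
    using insert by (subst charpoly_on_block) auto
  moreover have "charpoly_on {x} (\<lambda>i j. if i = j then l i else 0) = [:- l x, 1:]"
    by (simp add: charpoly_on_def det_on_def)
  ultimately show ?case
    using insert by simp
qed

section \<open>Symmetric matrices with simple spectrum\<close>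

lemma eigenvalue_matE:
  fixes g :: "nat \<Rightarrow> nat \<Rightarrow> 'a::field"
  assumes "eigenvalue (mat n n (\<lambda>(i, j). g i j)) x"
  obtains v where "\<exists>i<n. v i \<noteq> 0" "\<And>i. i < n \<Longrightarrow> (\<Sum>j=0..<n. g i j * v j) = x * v i"
proof -
  from assms obtain w where w: "w \<in> carrier_vec n" "w \<noteq> 0\<^sub>v n"
    and eq: "mat n n (\<lambda>(i, j). g i j) *\<^sub>v w = x \<cdot>\<^sub>v w"
    unfolding eigenvalue_def eigenvector_def by auto
  have "\<exists>i<n. w $ i \<noteq> 0"
  proof (rule ccontr)
    assume "\<not> (\<exists>i<n. w $ i \<noteq> 0)"
    then have "w = 0\<^sub>v n"
      using w(1) by (intro eq_vecI) auto
    with w(2) show False by simp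
  qed
  moreover have "(\<Sum>j=0..<n. g i j * w $ j) = x * w $ i" if "i < n" for i
    using arg_cong[OF eq, of "\<lambda>u. u $ i"] that w(1) by (simp add: scalar_prod_def)
  ultimately show ?thesis
    using that by blast
qed

text \<open>The Hermitian form \<open>s\<close> of the eigenvector equals \<open>z\<close> times its
  positive squared norm, and the symmetry of \<open>g\<close> makes \<open>s\<close> its own
  conjugate.\<close>

lemma symmetric_eigenvalue_real:
  fixes g :: "nat \<Rightarrow> nat \<Rightarrow> real"
  assumes sym: "\<And>i j. i < n \<Longrightarrow> j < n \<Longrightarrow> g i j = g j i"
    and "eigenvalue (mat n n (\<lambda>(i, j). complex_of_real (g i j))) z"
  shows "z \<in> \<real>"
proof -
  obtain v where v: "\<exists>i<n. v i \<noteq> 0"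
    and eq: "\<And>i. i < n \<Longrightarrow> (\<Sum>j=0..<n. complex_of_real (g i j) * v j) = z * v i"
    by (rule eigenvalue_matE[OF assms(2)]) blast
  define s where "s = (\<Sum>i=0..<n. \<Sum>j=0..<n. cnj (v i) * (complex_of_real (g i j) * v j))"
  define N where "N = (\<Sum>i=0..<n. (cmod (v i))\<^sup>2)"
  have "s = (\<Sum>i=0..<n. cnj (v i) * (z * v i))"
    unfolding s_def by (rule sum.cong) (auto simp: sum_distrib_left[symmetric] eq)
  also have "\<dots> = z * complex_of_real N"
    unfolding N_def of_real_sum sum_distrib_left
    by (rule sum.cong) (auto simp: complex_norm_square mult_ac simp del: of_real_power)
  finally have s: "s = z * complex_of_real N" .
  have "cnj s = (\<Sum>i=0..<n. \<Sum>j=0..<n. cnj (v j) * (complex_of_real (g i j) * v i))"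
    unfolding s_def by (simp add: mult_ac)
  also have "\<dots> = (\<Sum>j=0..<n. \<Sum>i=0..<n. cnj (v j) * (complex_of_real (g i j) * v i))"
    by (rule sum.swap)
  also have "\<dots> = s"
    unfolding s_def by (intro sum.cong refl) (simp add: sym)
  finally have "cnj z * complex_of_real N = z * complex_of_real N"
    using s by simp
  moreover obtain i where "i < n" "v i \<noteq> 0"
    using v by blast
  then have "N > 0"
    unfolding N_def by (intro sum_pos2[of _ i]) auto
  ultimately have "cnj z = z" by simp
  then show ?thesis
    by (simp add: Reals_cnj_iff)
qed

text \<open>The polynomial splits over the complex numbers and all its roots are real; the
  factorisation descends because the embedding of real polynomials is injective.\<close>

lemma charpoly_on_symmetric_splits:
  assumes "finite V" and sym: "\<And>i j. i \<in> V \<Longrightarrow> j \<in> V \<Longrightarrow> M i j = M j i"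
  obtains bs where "length bs = card V" "charpoly_on V M = (\<Prod>b\<leftarrow>bs. [:- b, 1:])"
proof -
  let ?n = "card V"
  obtain f where f: "bij_betw f {0..<?n} V"
    using ex_bij_betw_nat_finite[OF assms(1)] by blast
  have fV: "f k \<in> V" if "k < ?n" for k
    using f that by (auto simp: bij_betw_def)
  define A where "A = mat ?n ?n (\<lambda>(i, j). M (f i) (f j))"
  let ?A = "map_mat complex_of_real A"
  have A: "A \<in> carrier_mat ?n ?n" by (simp add: A_def)
  then have A': "?A \<in> carrier_mat ?n ?n" by simp
  have A'_eq: "?A = mat ?n ?n (\<lambda>(i, j). complex_of_real (M (f i) (f j)))"
    by (rule eq_matI) (auto simp: A_def)
  obtain as where as: "char_poly ?A = (\<Prod>a\<leftarrow>as. [:- a, 1:])" "length as = ?n"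
    using char_poly_factorized[OF A'] by blast
  have "a \<in> \<real>" if "a \<in> set as" for a
  proof -
    have "poly (char_poly ?A) a = 0"
      unfolding as(1) poly_prod_list using that by (auto simp: prod_list_zero_iff)
    then have "eigenvalue ?A a"
      using eigenvalue_root_char_poly[OF A'] by blast
    then show ?thesis
      unfolding A'_eq by (rule symmetric_eigenvalue_real[rotated]) (simp add: sym fV)
  qed
  then have "map (\<lambda>a. complex_of_real (Re a)) as = as"
    by (intro map_idI) (simp add: of_real_Re)
  then have "as = map complex_of_real (map Re as)"
    by (simp add: comp_def)
  then obtain bs where bs: "as = map complex_of_real bs" ..
  interpret inj: map_poly_inj_comm_ring_hom complex_of_real ..
  have "map_poly complex_of_real (char_poly A) = map_poly complex_of_real (\<Prod>b\<leftarrow>bs. [:- b, 1:])"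
    unfolding of_real_hom.char_poly_hom[OF A, symmetric] as(1) bs
    by (simp add: inj.hom_prod_list comp_def)
  then have "char_poly A = (\<Prod>b\<leftarrow>bs. [:- b, 1:])"
    using inj.injectivity by blast
  then have "charpoly_on V M = (\<Prod>b\<leftarrow>bs. [:- b, 1:])"
    unfolding charpoly_on_eq_char_poly[OF f] A_def .
  moreover have "length bs = card V"
    using as(2) bs by simp
  ultimately show ?thesis
    using that by blast
qed

lemma proots_linear_factors: "proots (\<Prod>b\<leftarrow>bs. [:- b, 1:]) = mset (bs :: 'a::idom list)"
proof (induction bs)
  case (Cons b bs)
  have "(\<Prod>b\<leftarrow>bs. [:- b, 1:]) \<noteq> 0"
    by (auto simp: prod_list_zero_iff)
  then show ?case
    using Cons by (simp add: proots_mult del: mult_pCons_left)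
qed simp

text \<open>There are \<open>card V\<close> roots counted with multiplicity, and a multiplicity of
  at most one makes them distinct. Hence one eigenvector per eigenvalue will be enough for a
  basis.\<close>

lemma card_simple_spectrum:
  assumes "finite V" and "\<And>i j. i \<in> V \<Longrightarrow> j \<in> V \<Longrightarrow> M i j = M j i"
    and "\<forall>x. count (spectrum_on V M) x \<le> 1"
  shows "card (set_mset (spectrum_on V M)) = card V"
proof -
  obtain bs where bs: "length bs = card V" "charpoly_on V M = (\<Prod>b\<leftarrow>bs. [:- b, 1:])"
    using charpoly_on_symmetric_splits[of V M] assms(1,2) by blast
  have spec: "spectrum_on V M = mset bs"
    unfolding spectrum_on_def bs(2) by (rule proots_linear_factors)
  have "distinct bs"
    unfolding distinct_count_atmost_1
  proof
    fix x
    show "count (mset bs) x = (if x \<in> set bs then 1 else 0)"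
    proof (cases "x \<in> set bs")
      case True
      then have "count (mset bs) x > 0" by simp
      with assms(3) True show ?thesis
        unfolding spec by (metis One_nat_def Suc_leI le_antisym)
    qed (simp add: count_eq_zero_iff)
  qed
  then show ?thesis
    using bs(1) by (simp add: spec distinct_card)
qed

lemma eigenvector_on:
  assumes "finite V" and "x \<in># spectrum_on V M"
  obtains v where "(\<Sum>i\<in>V. v i * v i) = 1" "\<And>i. i \<in> V \<Longrightarrow> (\<Sum>j\<in>V. M i j * v j) = x * v i"
proof -
  let ?n = "card V"
  obtain f where f: "bij_betw f {0..<?n} V"
    using ex_bij_betw_nat_finite[OF assms(1)] by blast
  have "poly (charpoly_on V M) x = 0"
    using assms charpoly_on_nonzero[OF assms(1)] by (simp add: spectrum_on_def)
  then have "eigenvalue (mat ?n ?n (\<lambda>(i, j). M (f i) (f j))) x"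
    unfolding charpoly_on_eq_char_poly[OF f]
    by (subst eigenvalue_root_char_poly[of _ ?n]) auto
  then obtain u where u: "\<exists>i<?n. u i \<noteq> 0"
    and eq: "\<And>i. i < ?n \<Longrightarrow> (\<Sum>j=0..<?n. M (f i) (f j) * u j) = x * u i"
    by (rule eigenvalue_matE) blast
  define w where "w i = u (inv_into {0..<?n} f i)" for i
  have wf: "w (f i) = u i" if "i < ?n" for i
    using f that by (simp add: w_def bij_betw_inv_into_left)
  have weq: "(\<Sum>j\<in>V. M i j * w j) = x * w i" if "i \<in> V" for i
  proof -
    have "i \<in> f ` {0..<?n}"
      using f that by (simp add: bij_betw_imp_surj_on)
    then obtain k where k: "k < ?n" "i = f k" by auto
    have "(\<Sum>j\<in>V. M i j * w j) = (\<Sum>j=0..<?n. M (f k) (f j) * u j)"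
      unfolding sum.reindex_bij_betw[OF f, symmetric] by (auto simp: wf k)
    then show ?thesis
      using eq k wf by simp
  qed
  define N where "N = sqrt (\<Sum>i\<in>V. w i * w i)"
  obtain k where "k < ?n" "u k \<noteq> 0"
    using u by blast
  then have "f k \<in> V" "w (f k) \<noteq> 0"
    using f wf by (auto dest: bij_betwE)
  then have pos: "(\<Sum>i\<in>V. w i * w i) > 0"
    using assms(1) by (intro sum_pos2[of _ "f k"]) (auto simp: zero_less_mult_iff)
  then have N: "N > 0" "N * N = (\<Sum>i\<in>V. w i * w i)"
    by (auto simp: N_def)
  show ?thesis
  proof
    show "(\<Sum>i\<in>V. w i / N * (w i / N)) = 1"
      using N pos by (simp add: sum_divide_distrib[symmetric])
    show "(\<Sum>j\<in>V. M i j * (w j / N)) = x * (w i / N)" if "i \<in> V" for i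
      using weq[OF that] by (simp add: sum_divide_distrib[symmetric])
  qed
qed

text \<open>Moving \<open>M\<close> from one factor of the inner product to the other shows that
  \<open>x\<close> times it equals \<open>y\<close> times it.\<close>

lemma symmetric_eigenvectors_orthogonal:
  fixes M :: "'a \<Rightarrow> 'a \<Rightarrow> real"
  assumes sym: "\<And>i j. i \<in> V \<Longrightarrow> j \<in> V \<Longrightarrow> M i j = M j i"
    and u: "\<And>i. i \<in> V \<Longrightarrow> (\<Sum>j\<in>V. M i j * u j) = x * u i"
    and v: "\<And>i. i \<in> V \<Longrightarrow> (\<Sum>j\<in>V. M i j * v j) = y * v i"
    and "x \<noteq> y"
  shows "(\<Sum>i\<in>V. u i * v i) = 0"
proof -
  have "x * (\<Sum>i\<in>V. u i * v i) = (\<Sum>i\<in>V. \<Sum>j\<in>V. M i j * u j * v i)"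
    by (simp add: sum_distrib_left sum_distrib_right[symmetric] u mult.assoc[symmetric])
  also have "\<dots> = (\<Sum>j\<in>V. \<Sum>i\<in>V. M i j * u j * v i)"
    by (rule sum.swap)
  also have "\<dots> = (\<Sum>j\<in>V. \<Sum>i\<in>V. u j * (M j i * v i))"
    by (intro sum.cong refl) (simp add: sym)
  also have "\<dots> = y * (\<Sum>i\<in>V. u i * v i)"
    by (simp add: sum_distrib_left[symmetric] v) (simp add: sum_distrib_left mult_ac)
  finally show ?thesis
    using \<open>x \<noteq> y\<close> by simp
qed

text \<open>The vectors are indexed by the eigenvalues themselves, so different indices
  automatically give orthogonal vectors.\<close>

lemma orthonormal_eigenvectors_on:
  assumes "finite V" and sym: "\<And>i j. i \<in> V \<Longrightarrow> j \<in> V \<Longrightarrow> M i j = M j i"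
  shows "\<exists>q. \<forall>x\<in>set_mset (spectrum_on V M).
     (\<forall>i\<in>V. (\<Sum>j\<in>V. M i j * q x j) = x * q x i) \<and>
     (\<forall>y\<in>set_mset (spectrum_on V M). (\<Sum>i\<in>V. q x i * q y i) = (if x = y then 1 else 0))"
proof -
  have "\<forall>x\<in>set_mset (spectrum_on V M).
      \<exists>v. (\<Sum>i\<in>V. v i * v i) = 1 \<and> (\<forall>i\<in>V. (\<Sum>j\<in>V. M i j * v j) = x * v i)"
  proof
    fix x assume "x \<in># spectrum_on V M"
    then obtain v where "(\<Sum>i\<in>V. v i * v i) = 1"
      "\<And>i. i \<in> V \<Longrightarrow> (\<Sum>j\<in>V. M i j * v j) = x * v i"
      by (rule eigenvector_on[OF assms(1)]) blast
    then show "\<exists>v. (\<Sum>i\<in>V. v i * v i) = 1 \<and> (\<forall>i\<in>V. (\<Sum>j\<in>V. M i j * v j) = x * v i)"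
      by blast
  qed
  then obtain q where q: "\<forall>x\<in>set_mset (spectrum_on V M).
      (\<Sum>i\<in>V. q x i * q x i) = 1 \<and> (\<forall>i\<in>V. (\<Sum>j\<in>V. M i j * q x j) = x * q x i)"
    by (rule bchoice[THEN exE])
  have "(\<Sum>i\<in>V. q x i * q y i) = (if x = y then 1 else 0)"
    if xy: "x \<in># spectrum_on V M" "y \<in># spectrum_on V M" for x y
  proof (cases "x = y")
    case False
    then have "(\<Sum>i\<in>V. q x i * q y i) = 0"
      using xy q sym
      by (intro symmetric_eigenvectors_orthogonal[where M = M and x = x and y = y]) auto
    with False show ?thesis by simp
  qed (use q xy in auto)
  with q show ?thesis
    by (intro exI[of _ q]) auto
qed

section \<open>Isospectral perturbation of a diagonal matrix\<close>

definition orthogonal_on :: "'a set \<Rightarrow> ('a \<Rightarrow> 'a \<Rightarrow> real) \<Rightarrow> bool" where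
  "orthogonal_on V P \<longleftrightarrow>
     (\<forall>i\<in>V. \<forall>j\<in>V. (\<Sum>k\<in>V. P k i * P k j) = (if i = j then 1 else 0))"

lemma orthogonal_on_columns:
  "orthogonal_on V P \<Longrightarrow> i \<in> V \<Longrightarrow> j \<in> V \<Longrightarrow>
     (\<Sum>k\<in>V. P k i * P k j) = (if i = j then 1 else 0)"
  by (simp add: orthogonal_on_def)

lemma orthogonal_on_rows:
  assumes "finite V" "orthogonal_on V P" "i \<in> V" "j \<in> V"
  shows "(\<Sum>k\<in>V. P i k * P j k) = (if i = j then 1 else 0)"
  using left_right_inverse_on[of V "\<lambda>i k. P k i" P i j] assms
  by (simp add: orthogonal_on_def)

text \<open>\<open>l\<close> is the prescribed simple spectrum, one eigenvalue per index;
  \<open>d\<close> bounds from below the denominators that occur in the eigenvector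
  equations.\<close>

locale spectral_gap =
  fixes V :: "'a set" and l :: "'a \<Rightarrow> real" and d :: real
  assumes finite_V: "finite V" and d_pos: "d > 0"
    and gap: "i \<in> V \<Longrightarrow> j \<in> V \<Longrightarrow> i \<noteq> j \<Longrightarrow> d \<le> \<bar>l j - l i\<bar>"
begin

text \<open>Chosen so that \<open>card V * radius\<close> is at most \<open>d / 6\<close>: three
  error terms of that size then give the contraction factor 1/2.\<close>

definition radius :: real where
  "radius = d / (6 * (card V + 1))"

lemma radius_pos: "radius > 0"
  using d_pos by (simp add: radius_def)

lemma card_mult_radius: "6 * (card V * radius) \<le> d"
  using d_pos by (simp add: radius_def field_simps)

text \<open>Only the off-diagonal part is prescribed by \<open>X\<close>. The diagonal is left open,
  since it is what must be adjusted to keep the spectrum equal to \<open>l\<close>.\<close>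

definition admissible :: "('a \<Rightarrow> 'a \<Rightarrow> real) \<Rightarrow> bool" where
  "admissible X \<longleftrightarrow> (\<forall>i\<in>V. X i i = 0) \<and>
     (\<forall>i\<in>V. \<forall>j\<in>V. X i j = X j i \<and> \<bar>X i j\<bar> \<le> radius)"

lemma admissibleD:
  assumes "admissible X" "i \<in> V" "j \<in> V"
  shows "X i i = 0" "X i j = X j i" "\<bar>X i j\<bar> \<le> radius"
  using assms by (simp_all add: admissible_def)

section \<open>Contraction estimates for the eigenvector equations\<close>

lemma abs_sum_mult_le:
  assumes "\<And>k. k \<in> V \<Longrightarrow> \<bar>f k\<bar> \<le> A" "\<And>k. k \<in> V \<Longrightarrow> \<bar>g k\<bar> \<le> B"
  shows "\<bar>\<Sum>k\<in>V. f k * g k\<bar> \<le> card V * (A * (B :: real))"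
proof -
  have "\<bar>\<Sum>k\<in>V. f k * g k\<bar> \<le> (\<Sum>k\<in>V. \<bar>f k * g k\<bar>)"
    by (rule sum_abs)
  also have "\<dots> \<le> (\<Sum>k\<in>V. A * B)"
  proof (rule sum_mono)
    fix k assume "k \<in> V"
    then have "\<bar>f k\<bar> * \<bar>g k\<bar> \<le> A * B"
      using assms[of k] by (intro mult_mono) (auto intro: order_trans[OF abs_ge_zero])
    then show "\<bar>f k * g k\<bar> \<le> A * B" by (simp add: abs_mult)
  qed
  finally show ?thesis by simp
qed

text \<open>If column \<open>j\<close> of \<open>Y\<close> has \<open>Y j j = 1\<close> and is an eigenvector for \<open>l j\<close> of \<open>X\<close> plus a diagonal
  matrix, then row \<open>j\<close> of the eigenvalue equation determines the \<open>j\<close>-th diagonal entry as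
  \<open>l j - (\<Sum>k\<in>V. X j k * Y k j)\<close>, and the other rows say that \<open>Y\<close> is a fixed point of \<open>step X\<close>.\<close>

definition step :: "('a \<Rightarrow> 'a \<Rightarrow> real) \<Rightarrow> ('a \<Rightarrow> 'a \<Rightarrow> real) \<Rightarrow> 'a \<Rightarrow> 'a \<Rightarrow> real" where
  "step X Y i j = (if i = j then 1
     else ((\<Sum>k\<in>V. X i k * Y k j) - (\<Sum>k\<in>V. X i k * Y k i) * Y i j) / (l j - l i))"

lemma abs_divide_gap_le:
  assumes "i \<in> V" "j \<in> V" "i \<noteq> j" "\<bar>a\<bar> \<le> b * d"
  shows "\<bar>a / (l j - l i)\<bar> \<le> b"
proof -
  have g: "d \<le> \<bar>l j - l i\<bar>" using gap assms by blast
  have "0 \<le> b" using assms(4) d_pos by (smt (verit) zero_le_mult_iff)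
  then have "\<bar>a\<bar> \<le> b * \<bar>l j - l i\<bar>"
    using assms(4) mult_left_mono[OF g] by fastforce
  then show ?thesis
    using g d_pos \<open>0 \<le> b\<close> by (simp add: abs_divide divide_le_eq)
qed

text \<open>Both terms of the numerator are at most \<open>card V * radius\<close> and the
  denominator is at least \<open>d\<close> in absolute value, so \<open>step X\<close> preserves the
  unit ball of the maximum norm.\<close>

lemma step_bounded:
  assumes X: "admissible X" and Y: "\<And>i j. i \<in> V \<Longrightarrow> j \<in> V \<Longrightarrow> \<bar>Y i j\<bar> \<le> 1"
    and ij: "i \<in> V" "j \<in> V"
  shows "\<bar>step X Y i j\<bar> \<le> 1"
proof (cases "i = j")
  case False
  have a: "\<bar>\<Sum>k\<in>V. X i k * Y k m\<bar> \<le> card V * (radius * 1)" if "m \<in> V" for m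
    using admissibleD(3)[OF X] Y ij that by (intro abs_sum_mult_le) auto
  have "\<bar>(\<Sum>k\<in>V. X i k * Y k i) * Y i j\<bar> \<le> (card V * (radius * 1)) * 1"
    unfolding abs_mult using a Y ij radius_pos by (intro mult_mono) auto
  then have "\<bar>(\<Sum>k\<in>V. X i k * Y k j) - (\<Sum>k\<in>V. X i k * Y k i) * Y i j\<bar> \<le> 1 * d"
    using a[OF ij(2)] card_mult_radius d_pos by linarith
  then show ?thesis
    using abs_divide_gap_le[OF ij False] False by (simp add: step_def)
qed (simp add: step_def)

text \<open>The quadratic term is split as in the product rule. This leaves three differences, each
  at most \<open>card V * radius * D\<close>, and the choice of \<open>radius\<close> bounds their
  sum by \<open>D / 2 * d\<close>.\<close>

lemma step_contraction:
  assumes X: "admissible X"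
    and Y: "\<And>i j. i \<in> V \<Longrightarrow> j \<in> V \<Longrightarrow> \<bar>Y i j\<bar> \<le> 1"
    and Y': "\<And>i j. i \<in> V \<Longrightarrow> j \<in> V \<Longrightarrow> \<bar>Y' i j\<bar> \<le> 1"
    and D: "\<And>i j. i \<in> V \<Longrightarrow> j \<in> V \<Longrightarrow> \<bar>Y i j - Y' i j\<bar> \<le> D"
    and ij: "i \<in> V" "j \<in> V"
  shows "\<bar>step X Y i j - step X Y' i j\<bar> \<le> D / 2"
proof (cases "i = j")
  case True
  then show ?thesis
    using order_trans[OF abs_ge_zero D[OF ij]] by (simp add: step_def)
next
  case False
  define s where "s Y m = (\<Sum>k\<in>V. X i k * Y k m)" for Y :: "'a \<Rightarrow> 'a \<Rightarrow> real" and m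
  define c where "c = card V * radius"
  have D0: "0 \<le> D" using order_trans[OF abs_ge_zero D[OF ij]] .
  have c0: "0 \<le> c" "6 * c \<le> d" using radius_pos card_mult_radius by (auto simp: c_def)
  have a: "\<bar>s Y m - s Y' m\<bar> \<le> c * D" if "m \<in> V" for m
  proof -
    have "s Y m - s Y' m = (\<Sum>k\<in>V. X i k * (Y k m - Y' k m))"
      by (simp add: s_def sum_subtractf right_diff_distrib)
    then show ?thesis
      unfolding c_def using admissibleD(3)[OF X] D ij that
        abs_sum_mult_le[of "X i" radius "\<lambda>k. Y k m - Y' k m" D] by (simp add: mult_ac)
  qed
  have b: "\<bar>s Y i\<bar> \<le> c"
    unfolding s_def c_def using admissibleD(3)[OF X] Y ij abs_sum_mult_le[of "X i" radius "\<lambda>k. Y k i" 1]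
    by simp
  have "\<bar>s Y i * (Y i j - Y' i j)\<bar> \<le> c * D"
    unfolding abs_mult using b D ij c0 by (intro mult_mono) auto
  moreover have "\<bar>(s Y i - s Y' i) * Y' i j\<bar> \<le> (c * D) * 1"
    unfolding abs_mult using a Y' ij c0 D0 by (intro mult_mono) auto
  moreover have "(s Y j - s Y i * Y i j) - (s Y' j - s Y' i * Y' i j)
      = (s Y j - s Y' j) - s Y i * (Y i j - Y' i j) - (s Y i - s Y' i) * Y' i j"
    by (simp add: algebra_simps)
  ultimately have "\<bar>(s Y j - s Y i * Y i j) - (s Y' j - s Y' i * Y' i j)\<bar> \<le> 3 * (c * D)"
    using a[OF ij(2)] by linarith
  moreover have "3 * (c * D) \<le> D / 2 * d"
    using mult_right_mono[OF c0(2) D0] by (simp add: mult_ac)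
  ultimately have "\<bar>((s Y j - s Y i * Y i j) - (s Y' j - s Y' i * Y' i j)) / (l j - l i)\<bar> \<le> D / 2"
    by (intro abs_divide_gap_le[OF ij False]) linarith
  then show ?thesis
    using False by (simp add: step_def s_def diff_divide_distrib)
qed

text \<open>\<open>step\<close> is affine in \<open>X\<close> for fixed \<open>Y\<close>. Together
  with the contraction this makes the fixed point depend continuously on \<open>X\<close>.\<close>

lemma step_Lipschitz:
  fixes e :: real
  assumes Y: "\<And>i j. i \<in> V \<Longrightarrow> j \<in> V \<Longrightarrow> \<bar>Y i j\<bar> \<le> 1"
    and e: "\<And>i j. i \<in> V \<Longrightarrow> j \<in> V \<Longrightarrow> \<bar>X i j - X' i j\<bar> \<le> e"
    and ij: "i \<in> V" "j \<in> V"
  shows "\<bar>step X Y i j - step X' Y i j\<bar> \<le> 2 * card V * e / d"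
proof (cases "i = j")
  case True
  then show ?thesis
    using order_trans[OF abs_ge_zero e[OF ij]] d_pos by (simp add: step_def)
next
  case False
  define s where "s X m = (\<Sum>k\<in>V. X i k * Y k m)" for X :: "'a \<Rightarrow> 'a \<Rightarrow> real" and m
  have a: "\<bar>s X m - s X' m\<bar> \<le> card V * e" if "m \<in> V" for m
  proof -
    have "s X m - s X' m = (\<Sum>k\<in>V. (X i k - X' i k) * Y k m)"
      by (simp add: s_def sum_subtractf left_diff_distrib)
    then show ?thesis
      using Y e ij that abs_sum_mult_le[of "\<lambda>k. X i k - X' i k" e "\<lambda>k. Y k m" 1] by simp
  qed
  have "\<bar>(s X i - s X' i) * Y i j\<bar> \<le> (card V * e) * 1"
    unfolding abs_mult using a[OF ij(1)] Y[OF ij]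
    by (intro mult_mono) (auto intro: order_trans[OF abs_ge_zero])
  moreover have "(s X j - s X i * Y i j) - (s X' j - s X' i * Y i j)
      = (s X j - s X' j) - (s X i - s X' i) * Y i j"
    by (simp add: algebra_simps)
  ultimately have "\<bar>(s X j - s X i * Y i j) - (s X' j - s X' i * Y i j)\<bar>
      \<le> (2 * card V * e / d) * d"
    using a[OF ij(2)] d_pos by simp
  then have "\<bar>((s X j - s X i * Y i j) - (s X' j - s X' i * Y i j)) / (l j - l i)\<bar>
      \<le> 2 * card V * e / d"
    by (rule abs_divide_gap_le[OF ij False])
  then show ?thesis
    using False by (simp add: step_def s_def diff_divide_distrib)
qed

section \<open>The fixed point as a limit of Picard iterates\<close>

definition picard :: "('a \<Rightarrow> 'a \<Rightarrow> real) \<Rightarrow> nat \<Rightarrow> 'a \<Rightarrow> 'a \<Rightarrow> real" where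
  "picard X m = (step X ^^ m) (\<lambda>i j. if i = j then 1 else 0)"

text \<open>The iterates start at the identity, the eigenvector matrix for \<open>X = 0\<close>. By
  \<open>picard_tendsto\<close> the limit exists on \<open>V\<close> for admissible
  \<open>X\<close>.\<close>

definition fixp :: "('a \<Rightarrow> 'a \<Rightarrow> real) \<Rightarrow> 'a \<Rightarrow> 'a \<Rightarrow> real" where
  "fixp X i j = lim (\<lambda>m. picard X m i j)"

lemma picard_0: "picard X 0 = (\<lambda>i j. if i = j then 1 else 0)"
  by (simp add: picard_def)

lemma picard_Suc: "picard X (Suc m) = step X (picard X m)"
  by (simp add: picard_def)

lemma picard_bounded:
  assumes "admissible X"
  shows "i \<in> V \<Longrightarrow> j \<in> V \<Longrightarrow> \<bar>picard X m i j\<bar> \<le> 1"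
proof (induction m arbitrary: i j)
  case (Suc m)
  then show ?case
    unfolding picard_Suc using step_bounded[OF assms] by blast
qed (simp add: picard_0)

lemma picard_diff:
  assumes "admissible X"
  shows "i \<in> V \<Longrightarrow> j \<in> V \<Longrightarrow> \<bar>picard X (Suc m) i j - picard X m i j\<bar> \<le> 2 * (1 / 2) ^ m"
proof (induction m arbitrary: i j)
  case 0
  then show ?case
    using picard_bounded[OF assms, of i j "Suc 0"] picard_bounded[OF assms, of i j 0] by auto
next
  case (Suc m)
  have "\<bar>step X (picard X (Suc m)) i j - step X (picard X m) i j\<bar> \<le> (2 * (1 / 2) ^ m) / 2"
    using picard_bounded[OF assms] Suc by (intro step_contraction[OF assms]) auto
  then show ?case
    unfolding picard_Suc[of X "Suc m"] picard_Suc[of X m] by simp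
qed

text \<open>The increments are dominated by a geometric series, so their telescoping sum
  converges.\<close>

lemma picard_tendsto:
  assumes "admissible X" "i \<in> V" "j \<in> V"
  shows "(\<lambda>m. picard X m i j) \<longlonglongrightarrow> fixp X i j"
proof -
  let ?a = "\<lambda>m. picard X m i j"
  have "summable (\<lambda>m. 2 * (1 / 2 :: real) ^ m)"
    by (intro summable_mult summable_geometric) simp
  then have "summable (\<lambda>m. ?a (Suc m) - ?a m)"
    by (rule summable_comparison_test'[where N = 0]) (use picard_diff[OF assms] in simp)
  then have "convergent (\<lambda>n. \<Sum>m<n. ?a (Suc m) - ?a m)"
    by (simp add: summable_iff_convergent)
  then have "convergent (\<lambda>n. (\<Sum>m<n. ?a (Suc m) - ?a m) + ?a 0)"
    by (intro convergent_add convergent_const)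
  then have "convergent ?a"
    unfolding sum_lessThan_telescope[of ?a] by simp
  then show ?thesis
    by (simp add: fixp_def convergent_LIMSEQ_iff)
qed

lemma fixp_bounded:
  assumes "admissible X" "i \<in> V" "j \<in> V"
  shows "\<bar>fixp X i j\<bar> \<le> 1"
proof (rule LIMSEQ_le_const2)
  show "(\<lambda>m. \<bar>picard X m i j\<bar>) \<longlonglongrightarrow> \<bar>fixp X i j\<bar>"
    by (intro tendsto_rabs picard_tendsto assms)
qed (use picard_bounded[OF assms] in blast)

text \<open>Off the diagonal \<open>step X\<close> consists of finite sums and products over a
  constant nonzero denominator, so the limit may be taken on both sides of the iteration.\<close>

lemma fixp_fixed:
  assumes "admissible X" "i \<in> V" "j \<in> V"
  shows "step X (fixp X) i j = fixp X i j"
proof (rule LIMSEQ_unique)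
  show "(\<lambda>m. picard X (Suc m) i j) \<longlonglongrightarrow> fixp X i j"
    using picard_tendsto[OF assms] by (rule LIMSEQ_Suc)
  show "(\<lambda>m. picard X (Suc m) i j) \<longlonglongrightarrow> step X (fixp X) i j"
  proof (cases "i = j")
    case False
    then have "l j - l i \<noteq> 0" using gap assms d_pos by force
    then show ?thesis
      unfolding picard_Suc step_def using False
      by (auto intro!: tendsto_intros picard_tendsto assms)
  qed (simp add: picard_Suc step_def)
qed

lemma fixp_diag:
  assumes "admissible X" "i \<in> V"
  shows "fixp X i i = 1"
  using fixp_fixed[OF assms(1,2,2)] by (simp add: step_def)

text \<open>Let \<open>D\<close> be the largest entrywise distance of the two fixed points. Changing
  first the argument and then the parameter of \<open>step\<close> gives
  \<open>D \<le> D / 2 + 2 * card V * e / d\<close>, and the term \<open>D / 2\<close> is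
  absorbed.\<close>

lemma fixp_Lipschitz:
  assumes X: "admissible X" and X': "admissible X'"
    and e: "\<And>i j. i \<in> V \<Longrightarrow> j \<in> V \<Longrightarrow> \<bar>X i j - X' i j\<bar> \<le> e"
    and ij: "i \<in> V" "j \<in> V"
  shows "\<bar>fixp X i j - fixp X' i j\<bar> \<le> 4 * card V / d * e"
proof -
  define S where "S = (\<lambda>(i, j). \<bar>fixp X i j - fixp X' i j\<bar>) ` (V \<times> V)"
  define D where "D = Max S"
  have fin: "finite S" "S \<noteq> {}"
    using finite_V ij by (auto simp: S_def)
  have le: "\<bar>fixp X i j - fixp X' i j\<bar> \<le> D" if "i \<in> V" "j \<in> V" for i j
    unfolding D_def using fin that by (intro Max_ge) (auto simp: S_def)
  have "D \<in> S"
    unfolding D_def using fin by (rule Max_in)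
  then obtain a b where ab: "a \<in> V" "b \<in> V" "D = \<bar>fixp X a b - fixp X' a b\<bar>"
    by (auto simp: S_def)
  have "\<bar>step X (fixp X) a b - step X (fixp X') a b\<bar> \<le> D / 2"
    by (rule step_contraction[OF X fixp_bounded[OF X] fixp_bounded[OF X'] le ab(1,2)])
  moreover have "\<bar>step X (fixp X') a b - step X' (fixp X') a b\<bar> \<le> 2 * card V * e / d"
    by (rule step_Lipschitz[OF fixp_bounded[OF X'] e ab(1,2)])
  ultimately have "D \<le> D / 2 + 2 * card V * e / d"
    using fixp_fixed[OF X ab(1,2)] fixp_fixed[OF X' ab(1,2)] ab(3) by linarith
  then have "D \<le> 4 * card V / d * e" by simp
  with le[OF ij] show ?thesis by linarith
qed

section \<open>Orthonormal eigenvectors for a prescribed off-diagonal part\<close>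

definition eigenbasis :: "('a \<Rightarrow> 'a \<Rightarrow> real) \<Rightarrow> 'a \<Rightarrow> 'a \<Rightarrow> real" where
  "eigenbasis X i j = fixp X i j / sqrt (\<Sum>k\<in>V. fixp X k j * fixp X k j)"

lemma norm_fixp_pos:
  assumes "admissible X" "j \<in> V"
  shows "(\<Sum>k\<in>V. fixp X k j * fixp X k j) > 0"
  using finite_V assms(2) fixp_diag[OF assms] by (intro sum_pos2[of V j]) auto

lemma eigenbasis_diag_pos:
  assumes "admissible X" "j \<in> V"
  shows "eigenbasis X j j > 0"
  using norm_fixp_pos[OF assms] fixp_diag[OF assms] by (simp add: eigenbasis_def)

text \<open>For \<open>i \<noteq> j\<close> this is the fixed point equation cleared of its
  denominator; for \<open>i = j\<close> the diagonal of \<open>A\<close> has been chosen to make it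
  true. Thus one matrix \<open>A\<close> with off-diagonal part \<open>X\<close> has every column of
  \<open>fixp X\<close> as eigenvector.\<close>

lemma fixp_eigenvector:
  assumes X: "admissible X" and ij: "i \<in> V" "j \<in> V"
  defines "A \<equiv> \<lambda>i k. if i = k then l i - (\<Sum>m\<in>V. X i m * fixp X m i) else X i k"
  shows "(\<Sum>k\<in>V. A i k * fixp X k j) = l j * fixp X i j"
proof -
  let ?s = "\<lambda>j. \<Sum>m\<in>V. X i m * fixp X m j"
  have "(\<Sum>k\<in>V. A i k * fixp X k j)
      = (\<Sum>k\<in>V. X i k * fixp X k j + (if k = i then (l i - ?s i) * fixp X k j else 0))"
    using admissibleD(1)[OF X ij(1) ij(1)] by (intro sum.cong) (auto simp: A_def)
  also have "\<dots> = ?s j + (l i - ?s i) * fixp X i j"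
    using finite_V ij by (simp add: sum.distrib)
  also have "\<dots> = l j * fixp X i j"
  proof (cases "i = j")
    case False
    then have "l j - l i \<noteq> 0" using gap ij d_pos by force
    then have "(l j - l i) * fixp X i j = ?s j - ?s i * fixp X i j"
      using fixp_fixed[OF X ij] False by (simp add: step_def field_simps)
    then show ?thesis by (simp add: algebra_simps)
  qed (use fixp_diag[OF X ij(1)] in simp)
  finally show ?thesis .
qed

text \<open>The columns are normalised eigenvectors of one symmetric matrix for distinct
  eigenvalues.\<close>

lemma orthogonal_eigenbasis:
  assumes X: "admissible X"
  shows "orthogonal_on V (eigenbasis X)"
  unfolding orthogonal_on_def
proof (intro ballI)
  fix i j assume ij: "i \<in> V" "j \<in> V"
  let ?N = "\<lambda>j. \<Sum>k\<in>V. fixp X k j * fixp X k j"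
  have eq: "(\<Sum>k\<in>V. eigenbasis X k i * eigenbasis X k j)
      = (\<Sum>k\<in>V. fixp X k i * fixp X k j) / (sqrt (?N i) * sqrt (?N j))"
    by (simp add: eigenbasis_def sum_divide_distrib)
  show "(\<Sum>k\<in>V. eigenbasis X k i * eigenbasis X k j) = (if i = j then 1 else 0)"
  proof (cases "i = j")
    case True
    then show ?thesis
      unfolding eq using norm_fixp_pos[OF X ij(1)] by simp
  next
    case False
    then have "l i \<noteq> l j" using gap[OF ij] d_pos by auto
    then have "(\<Sum>k\<in>V. fixp X k i * fixp X k j) = 0"
      using fixp_eigenvector[OF X _ ij(1)] fixp_eigenvector[OF X _ ij(2)] admissibleD(2)[OF X]
      by (intro symmetric_eigenvectors_orthogonal[where x = "l i" and y = "l j" and V = V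
          and M = "\<lambda>i k. if i = k then l i - (\<Sum>m\<in>V. X i m * fixp X m i) else X i k"]) auto
    with False show ?thesis unfolding eq by simp
  qed
qed

text \<open>Conjugating the diagonal matrix of \<open>l\<close> by the eigenbasis gives back the
  matrix \<open>A\<close> of \<open>fixp_eigenvector\<close>, whose off-diagonal part is
  \<open>X\<close>. So every admissible pattern is realised with spectrum \<open>l\<close>.\<close>

lemma eigenbasis_offdiag:
  assumes X: "admissible X" and ij: "i \<in> V" "j \<in> V" "i \<noteq> j"
  shows "(\<Sum>k\<in>V. l k * eigenbasis X i k * eigenbasis X j k) = X i j"
proof -
  define A where "A i k = (if i = k then l i - (\<Sum>m\<in>V. X i m * fixp X m i) else X i k)" for i k
  have ev: "l k * eigenbasis X i k = (\<Sum>m\<in>V. A i m * eigenbasis X m k)" if "k \<in> V" for k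
    using fixp_eigenvector[OF X ij(1) that]
    by (simp add: A_def eigenbasis_def sum_divide_distrib[symmetric])
  have "(\<Sum>k\<in>V. l k * eigenbasis X i k * eigenbasis X j k)
      = (\<Sum>k\<in>V. \<Sum>m\<in>V. A i m * (eigenbasis X m k * eigenbasis X j k))"
    by (intro sum.cong refl) (simp add: ev sum_distrib_right mult.assoc)
  also have "\<dots> = (\<Sum>m\<in>V. A i m * (\<Sum>k\<in>V. eigenbasis X m k * eigenbasis X j k))"
    by (subst sum.swap) (simp add: sum_distrib_left)
  also have "\<dots> = (\<Sum>m\<in>V. if m = j then A i m else 0)"
    using orthogonal_on_rows[OF finite_V orthogonal_eigenbasis[OF X]] ij
    by (intro sum.cong) auto
  also have "\<dots> = X i j"
    using finite_V ij by (simp add: A_def)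
  finally show ?thesis .
qed

lemma tendsto_eigenbasis:
  assumes X: "\<forall>\<^sub>F t in F. admissible (X t)" and X0: "admissible X0"
    and lim: "\<And>i j. i \<in> V \<Longrightarrow> j \<in> V \<Longrightarrow> ((\<lambda>t. X t i j) \<longlongrightarrow> X0 i j) F"
    and ij: "i \<in> V" "j \<in> V"
  shows "((\<lambda>t. eigenbasis (X t) i j) \<longlongrightarrow> eigenbasis X0 i j) F"
proof -
  \<comment> \<open>The total deviation bounds all entries uniformly, as the Lipschitz estimate
    requires, and still tends to 0.\<close>
  define e where "e t = (\<Sum>p\<in>V \<times> V. \<bar>X t (fst p) (snd p) - X0 (fst p) (snd p)\<bar>)" for t
  have e_le: "\<bar>X t i j - X0 i j\<bar> \<le> e t" if "i \<in> V" "j \<in> V" for t i j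
    unfolding e_def using that finite_V
    by (intro order_trans[OF _ member_le_sum[of "(i, j)"]]) auto
  have "(e \<longlongrightarrow> (\<Sum>p\<in>V \<times> V. \<bar>X0 (fst p) (snd p) - X0 (fst p) (snd p)\<bar>)) F"
    unfolding e_def by (intro tendsto_intros lim) auto
  then have "(e \<longlongrightarrow> 0) F" by simp
  then have e0: "((\<lambda>t. 4 * card V / d * e t) \<longlongrightarrow> 0) F"
    by (rule tendsto_mult_right_zero)
  have fixp: "((\<lambda>t. fixp (X t) i j) \<longlongrightarrow> fixp X0 i j) F" if "i \<in> V" "j \<in> V" for i j
  proof (rule LIM_zero_cancel, rule tendsto_0_le[OF e0, where K = 1])
    show "\<forall>\<^sub>F t in F. norm (fixp (X t) i j - fixp X0 i j) \<le> norm (4 * card V / d * e t) * 1"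
      using X
    proof eventually_elim
      case (elim t)
      have "\<bar>fixp (X t) i j - fixp X0 i j\<bar> \<le> 4 * card V / d * e t"
        by (rule fixp_Lipschitz[OF elim X0 e_le that])
      then show ?case
        using abs_ge_self[of "4 * card V / d * e t"] unfolding real_norm_def by linarith
    qed
  qed
  show ?thesis
    unfolding eigenbasis_def using norm_fixp_pos[OF X0 ij(2)]
    by (intro tendsto_intros fixp ij) auto
qed

end

section \<open>Generic eigenvectors for a connected graph\<close>

context spectral_gap
begin

text \<open>The diagonal of the matrix with spectrum \<open>l\<close> and off-diagonal part
  \<open>X\<close>.\<close>

definition diag_entry :: "('a \<Rightarrow> 'a \<Rightarrow> real) \<Rightarrow> 'a \<Rightarrow> real" where
  "diag_entry X u = (\<Sum>k\<in>V. l k * eigenbasis X u k * eigenbasis X u k)"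

text \<open>Row \<open>u\<close> of the eigenvalue equation for column \<open>j\<close>, with the
  diagonal term moved to the left.\<close>

lemma eigenbasis_row:
  assumes X: "admissible X" and uj: "u \<in> V" "j \<in> V"
  shows "(l j - diag_entry X u) * eigenbasis X u j = (\<Sum>i\<in>V. X u i * eigenbasis X i j)"
proof -
  have "(\<Sum>i\<in>V. (\<Sum>k\<in>V. l k * eigenbasis X u k * eigenbasis X i k) * eigenbasis X i j)
      = (\<Sum>i\<in>V. \<Sum>k\<in>V. l k * eigenbasis X u k * (eigenbasis X i k * eigenbasis X i j))"
    by (simp add: sum_distrib_right mult.assoc)
  also have "\<dots> = (\<Sum>k\<in>V. l k * eigenbasis X u k * (\<Sum>i\<in>V. eigenbasis X i k * eigenbasis X i j))"
    by (subst sum.swap) (simp add: sum_distrib_left)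
  also have "\<dots> = (\<Sum>k\<in>V. if k = j then l k * eigenbasis X u k else 0)"
    using orthogonal_on_columns[OF orthogonal_eigenbasis[OF X]] uj by (intro sum.cong) auto
  also have "\<dots> = l j * eigenbasis X u j"
    using finite_V uj by simp
  finally have "l j * eigenbasis X u j
      = (\<Sum>i\<in>V. (\<Sum>k\<in>V. l k * eigenbasis X u k * eigenbasis X i k) * eigenbasis X i j)" ..
  also have "\<dots> = (\<Sum>i\<in>V. X u i * eigenbasis X i j
      + (if i = u then diag_entry X u * eigenbasis X i j else 0))"
    using eigenbasis_offdiag[OF X uj(1)] admissibleD(1)[OF X uj(1) uj(1)]
    by (intro sum.cong) (auto simp: diag_entry_def)
  also have "\<dots> = (\<Sum>i\<in>V. X u i * eigenbasis X i j) + diag_entry X u * eigenbasis X u j"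
    using finite_V uj by (simp add: sum.distrib)
  finally show ?thesis
    by (simp add: algebra_simps)
qed

text \<open>If \<open>u\<close> has no neighbour, its row equation has right-hand side zero. The
  positive entry at \<open>(u, u)\<close> forces the diagonal value \<open>l u\<close>, the gap then
  kills the rest of row \<open>u\<close>, and orthogonality of the rows kills the rest of column
  \<open>u\<close>.\<close>

lemma eigenbasis_isolated:
  assumes X: "admissible X" and u: "u \<in> V" and zero: "\<And>i. i \<in> V \<Longrightarrow> X u i = 0"
  shows "diag_entry X u = l u"
    and "j \<in> V \<Longrightarrow> j \<noteq> u \<Longrightarrow> eigenbasis X u j = 0"
    and "j \<in> V \<Longrightarrow> j \<noteq> u \<Longrightarrow> eigenbasis X j u = 0"
proof -
  have row: "(l j - diag_entry X u) * eigenbasis X u j = 0" if "j \<in> V" for j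
    using eigenbasis_row[OF X u that] by (simp add: zero)
  have uu: "eigenbasis X u u > 0" by (rule eigenbasis_diag_pos[OF X u])
  then show d: "diag_entry X u = l u"
    using row[OF u] by simp
  have off: "eigenbasis X u j = 0" if "j \<in> V" "j \<noteq> u" for j
    using row[OF that(1)] gap[OF that(1) u that(2)] d_pos d by auto
  then show "j \<in> V \<Longrightarrow> j \<noteq> u \<Longrightarrow> eigenbasis X u j = 0" .
  assume j: "j \<in> V" "j \<noteq> u"
  have "0 = (\<Sum>k\<in>V. eigenbasis X j k * eigenbasis X u k)"
    using orthogonal_on_rows[OF finite_V orthogonal_eigenbasis[OF X] j(1) u] j(2) by simp
  also have "\<dots> = (\<Sum>k\<in>V. if k = u then eigenbasis X j u * eigenbasis X u u else 0)"
    by (intro sum.cong) (auto simp: off)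
  also have "\<dots> = eigenbasis X j u * eigenbasis X u u"
    using finite_V u by simp
  finally show "eigenbasis X j u = 0"
    using uu by simp
qed

text \<open>Edges of \<open>E\<close> inside \<open>S\<close> may still have weight zero, to be
  filled in at the end; vertices outside \<open>S\<close> are isolated.\<close>

definition supported :: "'a set set \<Rightarrow> 'a set \<Rightarrow> ('a \<Rightarrow> 'a \<Rightarrow> real) \<Rightarrow> bool" where
  "supported E S X \<longleftrightarrow> admissible X \<and>
     (\<forall>i\<in>V. \<forall>j\<in>V. X i j \<noteq> 0 \<longrightarrow> {i, j} \<in> E \<and> i \<in> S \<and> j \<in> S)"

text \<open>The second conjunct concerns entries of the resolvent of the matrix on \<open>S\<close> at the diagonal
  values of the vertices outside \<open>S\<close>; it drives the induction on \<open>S\<close>. The summand \<open>j = v\<close> vanishes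
  because of division by zero.\<close>

definition generic :: "('a \<Rightarrow> real) set \<Rightarrow> 'a set \<Rightarrow> ('a \<Rightarrow> 'a \<Rightarrow> real) \<Rightarrow> bool" where
  "generic C S X \<longleftrightarrow> (\<forall>c\<in>C. \<forall>w\<in>S. (\<Sum>j\<in>V. c j * eigenbasis X w j) \<noteq> 0) \<and>
     (\<forall>w\<in>S. \<forall>w'\<in>S. \<forall>v\<in>V - S.
        (\<Sum>j\<in>V. eigenbasis X w j * eigenbasis X w' j / (l v - l j)) \<noteq> 0)"

text \<open>All finite families \<open>C\<close> are allowed because the induction step applies the
  hypothesis to an enlarged family. Vectors vanishing on \<open>S\<close> must be excluded: rows in
  \<open>S\<close> of the eigenbasis of a supported \<open>X\<close> are zero in columns outside
  \<open>S\<close>.\<close>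

definition generically_realizable :: "'a set set \<Rightarrow> 'a set \<Rightarrow> bool" where
  "generically_realizable E S \<longleftrightarrow>
     (\<forall>C. finite C \<longrightarrow> (\<forall>c\<in>C. \<exists>j\<in>S. c j \<noteq> 0) \<longrightarrow> (\<exists>X. supported E S X \<and> generic C S X))"

text \<open>Without perturbation row \<open>s\<close> is zero except at \<open>s\<close>, so every
  sum has a single nonzero term.\<close>

lemma generically_realizable_singleton:
  assumes s: "s \<in> V"
  shows "generically_realizable E {s}"
  unfolding generically_realizable_def
proof (intro allI impI)
  fix C assume C: "\<forall>c\<in>C. \<exists>j\<in>{s}. c j \<noteq> (0::real)"
  let ?X = "\<lambda>i j. 0::real"
  have X: "admissible ?X"
    using radius_pos by (simp add: admissible_def)
  have pos: "eigenbasis ?X s s > 0" by (rule eigenbasis_diag_pos[OF X s])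
  have zero: "eigenbasis ?X s j = 0" if "j \<in> V" "j \<noteq> s" for j
    using eigenbasis_isolated(2)[OF X s] that by blast
  have single: "(\<Sum>j\<in>V. f j) = f s" if "\<And>j. j \<in> V \<Longrightarrow> j \<noteq> s \<Longrightarrow> f j = 0" for f :: "'a \<Rightarrow> real"
    using finite_V s that by (simp add: sum.remove[of V s])
  have "(\<Sum>j\<in>V. c j * eigenbasis ?X s j) \<noteq> 0" if "c \<in> C" for c
    using C that pos by (subst single) (auto simp: zero)
  moreover have "(\<Sum>j\<in>V. eigenbasis ?X s j * eigenbasis ?X s j / (l v - l j)) \<noteq> 0"
    if "v \<in> V" "v \<noteq> s" for v
    using gap[OF s that(1)] that d_pos pos by (subst single) (auto simp: zero)
  ultimately have "generic C {s} ?X"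
    by (auto simp: generic_def)
  with X show "\<exists>X. supported E {s} X \<and> generic C {s} X"
    by (auto simp: supported_def)
qed

text \<open>The pendant edge from \<open>p\<close> to \<open>u\<close> gets a weight
  \<open>e\<close> tending to 0. Quantities with nonzero limit are safe; the others are
  \<open>e\<close> times a quantity whose limit is nonzero by the hypothesis on
  \<open>S\<close>.\<close>

lemma generically_realizable_insert:
  assumes S: "generically_realizable E S" "S \<subseteq> V"
    and p: "p \<in> S" and u: "u \<in> V" "u \<notin> S" and edge: "{p, u} \<in> E"
  shows "generically_realizable E (insert u S)"
  unfolding generically_realizable_def
proof (intro allI impI)
  fix C :: "('a \<Rightarrow> real) set"
  assume "finite C" and C: "\<forall>c\<in>C. \<exists>j\<in>insert u S. c j \<noteq> 0"
  define C1 where "C1 = {c \<in> C. \<exists>j\<in>S. c j \<noteq> 0}"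
  \<comment> \<open>To first order in \<open>e\<close>, row \<open>u\<close> is row \<open>p\<close>
    with entry \<open>j\<close> divided by \<open>l j - l u\<close>; testing \<open>c\<close>
    against row \<open>u\<close> thus means testing \<open>shift c\<close> against row
    \<open>p\<close>. Division by zero gives \<open>shift c u = 0\<close>, which drops the summand
    at \<open>u\<close>.\<close>
  define shift where "shift c j = c j / (l j - l u)" for c j
  have l_ne: "l i \<noteq> l j" if "i \<in> V" "j \<in> V" "i \<noteq> j" for i j
    using gap[OF that] d_pos by auto
  have "\<forall>c\<in>C1 \<union> shift ` C1. \<exists>j\<in>S. c j \<noteq> 0"
  proof
    fix c assume "c \<in> C1 \<union> shift ` C1"
    then consider "c \<in> C1" | c1 where "c1 \<in> C1" "c = shift c1" by blast
    then show "\<exists>j\<in>S. c j \<noteq> 0"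
    proof cases
      case 2
      then obtain j where "j \<in> S" "c1 j \<noteq> 0" by (auto simp: C1_def)
      moreover from this have "l j \<noteq> l u"
        using l_ne S(2) u by blast
      ultimately show ?thesis
        using 2 by (auto simp: shift_def)
    qed (simp add: C1_def)
  qed
  moreover have "finite (C1 \<union> shift ` C1)"
    using \<open>finite C\<close> by (simp add: C1_def)
  ultimately obtain X0 where "supported E S X0" and gen: "generic (C1 \<union> shift ` C1) S X0"
    using S(1) unfolding generically_realizable_def by blast
  then have X0: "admissible X0"
    and X0_supp: "\<And>i j. i \<in> V \<Longrightarrow> j \<in> V \<Longrightarrow> X0 i j \<noteq> 0 \<Longrightarrow> {i, j} \<in> E \<and> i \<in> S \<and> j \<in> S"
    by (auto simp: supported_def)
  have pV: "p \<in> V" and pu: "p \<noteq> u" using p u S(2) by auto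
  define X where "X e i j = (if {i, j} = {p, u} then e else X0 i j)" for e i j
  \<comment> \<open>Approaching 0 from the right keeps \<open>e\<close> nonzero, so that a factor
    \<open>e\<close> does no harm.\<close>
  let ?F = "at_right (0::real)"
  let ?P = "\<lambda>e. eigenbasis (X e)" and ?Q = "eigenbasis X0"
  let ?a = "\<lambda>e. diag_entry (X e) u"
  have small: "\<forall>\<^sub>F e in ?F. e \<in> {0<..<radius}"
    by (rule eventually_at_right_real[OF radius_pos])
  have adm: "admissible (X e)" if "e \<in> {0<..<radius}" for e
    using X0 that pu by (auto simp: admissible_def X_def doubleton_eq_iff)
  have X_supp: "supported E (insert u S) (X e)" if "e \<in> {0<..<radius}" for e
    unfolding supported_def
  proof (intro conjI ballI impI)
    fix i j assume ij: "i \<in> V" "j \<in> V" "X e i j \<noteq> 0"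
    show "{i, j} \<in> E" "i \<in> insert u S" "j \<in> insert u S"
      using ij X0_supp[OF ij(1,2)] edge p
      by (auto simp: X_def doubleton_eq_iff insert_commute[of u p] split: if_splits)
  qed (rule adm[OF that])
  have X0_u: "X0 u i = 0" "X0 i u = 0" if "i \<in> V" for i
    using X0_supp[of u i] X0_supp[of i u] u that by auto
  have X_lim: "((\<lambda>e. X e i j) \<longlongrightarrow> X0 i j) ?F" if "i \<in> V" "j \<in> V" for i j
  proof (cases "{i, j} = {p, u}")
    case True
    then have "X0 i j = 0" using X0_u pV by (auto simp: doubleton_eq_iff)
    with True show ?thesis by (simp add: X_def tendsto_ident_at)
  qed (simp add: X_def)
  have P_lim: "((\<lambda>e. ?P e i j) \<longlongrightarrow> ?Q i j) ?F" if "i \<in> V" "j \<in> V" for i j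
    using small adm
    by (intro tendsto_eigenbasis X0 X_lim that) (auto elim: eventually_mono)
  have iso0: "diag_entry X0 u = l u" "?Q u j = 0" "?Q j u = 0" if "j \<in> V" "j \<noteq> u" for j
    using eigenbasis_isolated[OF X0 u(1)] X0_u that by auto
  have uu0: "?Q u u > 0" by (rule eigenbasis_diag_pos[OF X0 u(1)])
  have a_lim: "(?a \<longlongrightarrow> l u) ?F"
  proof -
    have "(?a \<longlongrightarrow> diag_entry X0 u) ?F"
      unfolding diag_entry_def by (intro tendsto_intros P_lim u(1))
    then show ?thesis
      using iso0(1)[OF pV pu] by simp
  qed
  \<comment> \<open>The only neighbour of \<open>u\<close> is \<open>p\<close>, so the row equation
    has one term on the right.\<close>
  have row_u: "(l j - ?a e) * ?P e u j = e * ?P e p j"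
    if e: "e \<in> {0<..<radius}" and j: "j \<in> V" for e j
  proof -
    have "(l j - ?a e) * ?P e u j = (\<Sum>i\<in>V. X e u i * ?P e i j)"
      by (rule eigenbasis_row[OF adm[OF e] u(1) j])
    also have "\<dots> = (\<Sum>i\<in>V. if i = p then e * ?P e i j else 0)"
      using X0_u by (intro sum.cong) (auto simp: X_def doubleton_eq_iff)
    finally show ?thesis
      using finite_V pV by simp
  qed
  have iso: "?P e w v = 0"
    if e: "e \<in> {0<..<radius}" and v: "v \<in> V - insert u S" and w: "w \<in> V" "w \<noteq> v" for e v w
  proof (rule eigenbasis_isolated(3)[OF adm[OF e] _ _ w])
    show "X e v i = 0" if "i \<in> V" for i
      using X0_supp[of v i] that v p pu by (auto simp: X_def doubleton_eq_iff)
  qed (use v in auto)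
  have a_ne: "\<forall>\<^sub>F e in ?F. \<forall>j\<in>V - {u}. ?a e \<noteq> l j"
    using finite_V l_ne u(1)
    by (intro eventually_ball_finite ballI tendsto_imp_eventually_ne[OF a_lim]) auto
  have P_u: "?P e u j = e * (?P e p j / (l j - ?a e))"
    if "e \<in> {0<..<radius}" "\<forall>j\<in>V - {u}. ?a e \<noteq> l j" "j \<in> V" "j \<noteq> u" for e j
  proof -
    have "?a e \<noteq> l j" using that(2-4) by blast
    then have "l j - ?a e \<noteq> 0" by simp
    then show ?thesis
      using row_u[OF that(1,3)] by (simp add: eq_divide_eq mult.commute)
  qed
  have orth: "(\<Sum>j\<in>V. ?P e w j * ?P e w' j) = 0"
    if "e \<in> {0<..<radius}" "w \<in> V" "w' \<in> V" "w \<noteq> w'" for e w w'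
    using orthogonal_on_rows[OF finite_V orthogonal_eigenbasis[OF adm[OF that(1)]] that(2,3)]
      that(4) by simp

  have vectors: "\<forall>\<^sub>F e in ?F. (\<Sum>j\<in>V. c j * ?P e w j) \<noteq> 0"
    if c: "c \<in> C" and w: "w \<in> insert u S" for c w
  proof -
    have wV: "w \<in> V" using w u S(2) by auto
    have lim: "((\<lambda>e. \<Sum>j\<in>V. c j * ?P e w j) \<longlongrightarrow> (\<Sum>j\<in>V. c j * ?Q w j)) ?F"
      by (intro tendsto_intros P_lim wV)
    \<comment> \<open>The first two cases have a nonzero limit. In the last two the limit is zero
      and a factor \<open>e\<close> has to be extracted.\<close>
    consider "w \<in> S" "c \<in> C1" | "w = u" "c u \<noteq> 0" | "w = u" "c u = 0" | "w \<in> S" "c \<notin> C1"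
      using w by blast
    then show ?thesis
    proof cases
      case 1
      then show ?thesis
        using gen by (intro tendsto_imp_eventually_ne[OF lim]) (auto simp: generic_def)
    next
      case 2
      have "(\<Sum>j\<in>V. c j * ?Q w j) = (\<Sum>j\<in>V. if j = u then c u * ?Q u u else 0)"
        using iso0 2 by (intro sum.cong) auto
      also have "\<dots> \<noteq> 0"
        using finite_V u(1) uu0 2 by simp
      finally show ?thesis
        by (rule tendsto_imp_eventually_ne[OF lim])
    next
      case 3
      then have c1: "c \<in> C1"
        using C c by (auto simp: C1_def)
      let ?g = "\<lambda>e. \<Sum>j\<in>V - {u}. c j * (?P e p j / (l j - ?a e))"
      have lim: "(?g \<longlongrightarrow> (\<Sum>j\<in>V - {u}. c j * (?Q p j / (l j - l u)))) ?F"
        using l_ne u(1) by (intro tendsto_intros P_lim pV a_lim) auto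
      have "(\<Sum>j\<in>V - {u}. c j * (?Q p j / (l j - l u))) = (\<Sum>j\<in>V. shift c j * ?Q p j)"
        using finite_V u(1) by (simp add: sum.remove[of V u] shift_def)
      also have "\<dots> \<noteq> 0"
        using gen c1 p unfolding generic_def by blast
      finally have "\<forall>\<^sub>F e in ?F. ?g e \<noteq> 0"
        by (rule tendsto_imp_eventually_ne[OF lim])
      with small a_ne show ?thesis
      proof eventually_elim
        case (elim e)
        have "(\<Sum>j\<in>V. c j * ?P e w j) = (\<Sum>j\<in>V - {u}. c j * ?P e u j)"
          using finite_V u(1) 3 by (simp add: sum.remove[of V u])
        also have "\<dots> = (\<Sum>j\<in>V - {u}. e * (c j * (?P e p j / (l j - ?a e))))"
          using P_u[OF elim(1,2)] by (intro sum.cong) auto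
        also have "\<dots> = e * ?g e"
          by (simp only: sum_distrib_left)
        finally show ?case
          using elim by simp
      qed
    next
      case 4
      then have c0: "c j = 0" if "j \<in> S" for j
        using c that by (auto simp: C1_def)
      then have cu: "c u \<noteq> 0"
        using C c by auto
      \<comment> \<open>Here \<open>c\<close> vanishes on \<open>S\<close> and row \<open>w\<close>
        vanishes outside \<open>insert u S\<close>, so only \<open>c u * ?P e w u\<close> remains.
        Orthogonality of rows \<open>w\<close> and \<open>u\<close> expresses
        \<open>?P e w u * ?P e u u\<close> as \<open>e\<close> times a resolvent entry, whose limit
        is the one in \<open>generic\<close> with \<open>v = u\<close>.\<close>
      let ?g = "\<lambda>e. \<Sum>j\<in>V - {u}. ?P e w j * ?P e p j / (?a e - l j)"
      have lim: "(?g \<longlongrightarrow> (\<Sum>j\<in>V - {u}. ?Q w j * ?Q p j / (l u - l j))) ?F"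
        using l_ne u(1) by (intro tendsto_intros P_lim pV wV a_lim) auto
      have "(\<Sum>j\<in>V - {u}. ?Q w j * ?Q p j / (l u - l j))
          = (\<Sum>j\<in>V. ?Q w j * ?Q p j / (l u - l j))"
        using finite_V u(1) by (simp add: sum.remove[of V u])
      also have "\<dots> \<noteq> 0"
        using gen 4(1) p u unfolding generic_def by blast
      finally have "\<forall>\<^sub>F e in ?F. ?g e \<noteq> 0"
        by (rule tendsto_imp_eventually_ne[OF lim])
      with small a_ne show ?thesis
      proof eventually_elim
        case (elim e)
        have wu: "w \<noteq> u" using 4 u by auto
        have "0 = (\<Sum>j\<in>V. ?P e w j * ?P e u j)"
          using orth[OF elim(1) wV u(1) wu] by simp
        also have "\<dots> = ?P e w u * ?P e u u + (\<Sum>j\<in>V - {u}. ?P e w j * ?P e u j)"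
          using finite_V u(1) by (simp add: sum.remove[of V u])
        also have "(\<Sum>j\<in>V - {u}. ?P e w j * ?P e u j)
            = (\<Sum>j\<in>V - {u}. - (e * (?P e w j * ?P e p j / (?a e - l j))))"
        proof (rule sum.cong[OF refl])
          fix j assume j: "j \<in> V - {u}"
          have "?P e p j / (l j - ?a e) = - (?P e p j / (?a e - l j))"
            using minus_divide_right[of "?P e p j" "?a e - l j"] by simp
          then have "?P e u j = - (e * (?P e p j / (?a e - l j)))"
            using P_u[OF elim(1,2), of j] j by simp
          then show "?P e w j * ?P e u j = - (e * (?P e w j * ?P e p j / (?a e - l j)))"
            by simp
        qed
        also have "\<dots> = - (e * ?g e)"
          by (simp only: sum_negf sum_distrib_left)
        finally have "?P e w u * ?P e u u = e * ?g e" by simp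
        then have "?P e w u \<noteq> 0"
          using elim by auto
        moreover have "(\<Sum>j\<in>V. c j * ?P e w j) = (\<Sum>j\<in>V. if j = u then c u * ?P e w u else 0)"
        proof (rule sum.cong[OF refl])
          fix j assume j: "j \<in> V"
          show "c j * ?P e w j = (if j = u then c u * ?P e w u else 0)"
            using c0 iso[OF elim(1), of j w] j wV 4(1) by (cases "j \<in> S") auto
        qed
        ultimately show ?case
          using cu finite_V u(1) by simp
      qed
    qed
  qed

  have mixed: "\<forall>\<^sub>F e in ?F. (\<Sum>j\<in>V. ?P e w j * ?P e u j / (l v - l j)) \<noteq> 0"
    if w: "w \<in> S" and v: "v \<in> V - insert u S" for w v
  proof -
    have wV: "w \<in> V" and wu: "w \<noteq> u" using w u S(2) by auto
    let ?g = "\<lambda>e. \<Sum>j\<in>V. ?P e w j * ?P e p j / (l v - l j)"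
    \<comment> \<open>At \<open>j = v\<close> the denominator is zero and the limit rule for
      quotients fails; a constant factor, equal to 0 there, avoids it.\<close>
    have const: "((\<lambda>e. 1 / (l v - l j)) \<longlongrightarrow> 1 / (l v - l j)) ?F" for j
      by (rule tendsto_const)
    have "((\<lambda>e. \<Sum>j\<in>V. ?P e w j * ?P e p j * (1 / (l v - l j)))
        \<longlongrightarrow> (\<Sum>j\<in>V. ?Q w j * ?Q p j * (1 / (l v - l j)))) ?F"
      by (intro tendsto_sum tendsto_mult P_lim pV wV const)
    then have "(?g \<longlongrightarrow> (\<Sum>j\<in>V. ?Q w j * ?Q p j / (l v - l j))) ?F"
      by simp
    moreover have "(\<Sum>j\<in>V. ?Q w j * ?Q p j / (l v - l j)) \<noteq> 0"
      using gen w p v by (auto simp: generic_def)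
    ultimately have "\<forall>\<^sub>F e in ?F. ?g e \<noteq> 0"
      by (rule tendsto_imp_eventually_ne)
    with small show ?thesis
    proof eventually_elim
      case (elim e)
      \<comment> \<open>Write \<open>l v - ?a e\<close> as
        \<open>(l v - l j) + (l j - ?a e)\<close>. The first part sums to an inner product of
        different rows, hence to 0; by \<open>row_u\<close> the second gives \<open>e\<close> times
        the resolvent entry at \<open>w\<close> and \<open>p\<close>.\<close>
      have "(l v - ?a e) * (\<Sum>j\<in>V. ?P e w j * ?P e u j / (l v - l j))
          = (\<Sum>j\<in>V. ?P e w j * ?P e u j + e * (?P e w j * ?P e p j / (l v - l j)))"
        unfolding sum_distrib_left
      proof (rule sum.cong[OF refl])
        fix j assume j: "j \<in> V"
        show "(l v - ?a e) * (?P e w j * ?P e u j / (l v - l j))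
            = ?P e w j * ?P e u j + e * (?P e w j * ?P e p j / (l v - l j))"
        proof (cases "j = v")
          case True
          \<comment> \<open>The summand with zero denominator vanishes on both sides because
            \<open>v\<close> is still isolated.\<close>
          then have "?P e w j = 0"
            using iso[OF elim(1) v wV] v w by auto
          then show ?thesis by simp
        next
          case False
          then have ne: "l v - l j \<noteq> 0" using l_ne[of v j] v j by auto
          have "(l v - ?a e) * (?P e w j * ?P e u j)
              = (l v - l j) * (?P e w j * ?P e u j) + ?P e w j * ((l j - ?a e) * ?P e u j)"
            by (simp add: algebra_simps)
          also have "\<dots> = (l v - l j) * (?P e w j * ?P e u j) + e * (?P e w j * ?P e p j)"
            unfolding row_u[OF elim(1) j] by (simp add: algebra_simps)
          finally show ?thesis
            using ne by (simp add: divide_simps)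
        qed
      qed
      also have "\<dots> = e * ?g e"
        using orth[OF elim(1) wV u(1) wu] by (simp only: sum.distrib sum_distrib_left add_0)
      finally show ?case
        using elim by auto
    qed
  qed

  have resolvents: "\<forall>\<^sub>F e in ?F. (\<Sum>j\<in>V. ?P e w j * ?P e w' j / (l v - l j)) \<noteq> 0"
    if w: "w \<in> insert u S" "w' \<in> insert u S" and v: "v \<in> V - insert u S" for w w' v
  proof -
    have wV: "w \<in> V" "w' \<in> V" using w u S(2) by auto
    have const: "((\<lambda>e. 1 / (l v - l j)) \<longlongrightarrow> 1 / (l v - l j)) ?F" for j
      by (rule tendsto_const)
    have "((\<lambda>e. \<Sum>j\<in>V. ?P e w j * ?P e w' j * (1 / (l v - l j)))
        \<longlongrightarrow> (\<Sum>j\<in>V. ?Q w j * ?Q w' j * (1 / (l v - l j)))) ?F"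
      by (intro tendsto_sum tendsto_mult P_lim wV const)
    then have lim: "((\<lambda>e. \<Sum>j\<in>V. ?P e w j * ?P e w' j / (l v - l j))
        \<longlongrightarrow> (\<Sum>j\<in>V. ?Q w j * ?Q w' j / (l v - l j))) ?F"
      by simp
    consider "w \<in> S" "w' \<in> S" | "w \<in> S" "w' = u" | "w = u" "w' \<in> S" | "w = u" "w' = u"
      using w by blast
    then show ?thesis
    proof cases
      case 1
      then show ?thesis
        using gen v by (intro tendsto_imp_eventually_ne[OF lim]) (auto simp: generic_def)
    next
      case 2
      then show ?thesis using mixed v by simp
    next
      case 3
      then show ?thesis using mixed[of w' v] v by (simp add: mult.commute)
    next
      case 4
      have "(\<Sum>j\<in>V. ?Q w j * ?Q w' j / (l v - l j))
          = (\<Sum>j\<in>V. if j = u then ?Q u u * ?Q u u / (l v - l u) else 0)"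
        using iso0 4 by (intro sum.cong) auto
      also have "\<dots> \<noteq> 0"
        using finite_V u(1) uu0 l_ne[of v u] v by simp
      finally show ?thesis
        by (rule tendsto_imp_eventually_ne[OF lim])
    qed
  qed

  have fin: "finite (insert u S)" "finite (V - insert u S)"
    using finite_V S(2) by (auto intro: finite_subset)
  have "\<forall>\<^sub>F e in ?F. generic C (insert u S) (X e)"
    unfolding generic_def
    by (intro eventually_conj eventually_ball_finite ballI vectors resolvents fin \<open>finite C\<close>)
  with small have "\<forall>\<^sub>F e in ?F. supported E (insert u S) (X e) \<and> generic C (insert u S) (X e)"
    by eventually_elim (use X_supp in blast)
  then show "\<exists>X. supported E (insert u S) X \<and> generic C (insert u S) X"
    using eventually_happens'[OF trivial_limit_at_right_real] by blast
qed

text \<open>A maximal realizable set is all of \<open>V\<close>, since otherwise some edge leaves it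
  and its outer end can be attached.\<close>

lemma generically_realizable_connected:
  assumes "sgraph V E" "connected_graph V E"
  shows "generically_realizable E V"
proof -
  define F where "F = {S. S \<subseteq> V \<and> S \<noteq> {} \<and> generically_realizable E S}"
  have "finite F"
    using finite_V by (auto simp: F_def)
  moreover have "F \<noteq> {}"
  proof -
    obtain s where "s \<in> V" using assms(2) by (auto simp: connected_graph_def)
    then have "{s} \<in> F"
      using generically_realizable_singleton by (simp add: F_def)
    then show ?thesis by blast
  qed
  ultimately obtain S where S: "S \<in> F" and max: "\<And>T. T \<in> F \<Longrightarrow> S \<subseteq> T \<Longrightarrow> S = T"
    using finite_has_maximal[of F] by metis
  have "S = V"
  proof (rule ccontr)
    assume "S \<noteq> V"
    then obtain s t where st: "s \<in> S" "t \<in> V" "t \<notin> S" "s \<in> V"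
      using S by (auto simp: F_def)
    have "(s, t) \<in> {(x, y). {x, y} \<in> E}\<^sup>*"
      using assms(2) st by (auto simp: connected_graph_def)
    \<comment> \<open>A walk that starts in \<open>S\<close> either stays there or crosses an edge
      leaving \<open>S\<close>.\<close>
    then have "t \<in> S \<or> (\<exists>p\<in>S. \<exists>u. u \<notin> S \<and> {p, u} \<in> E)"
      by (induction rule: rtrancl_induct) (use st in auto)
    then obtain p u where pu: "p \<in> S" "u \<notin> S" "{p, u} \<in> E"
      using st by blast
    then have "u \<in> V"
      using assms(1) by (fastforce simp: sgraph_def doubleton_eq_iff)
    then have "insert u S \<in> F"
      using generically_realizable_insert[of E S p u] pu S by (auto simp: F_def)
    then show False
      using max[of "insert u S"] pu by blast
  qed
  with S show ?thesis by (simp add: F_def)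
qed

lemma generic_connected:
  assumes graph: "sgraph V E" "connected_graph V E"
    and "finite C" "\<And>c. c \<in> C \<Longrightarrow> \<exists>j\<in>V. c j \<noteq> 0"
  obtains P where "orthogonal_on V P"
    "(\<lambda>i j. \<Sum>k\<in>V. l k * P i k * P j k) \<in> S_graph V E"
    "\<And>c w. c \<in> C \<Longrightarrow> w \<in> V \<Longrightarrow> (\<Sum>j\<in>V. c j * P w j) \<noteq> 0"
proof -
  obtain X0 where "supported E V X0" and gen: "generic C V X0"
    using generically_realizable_connected[OF graph] assms(3,4)
    unfolding generically_realizable_def by blast
  then have X0: "admissible X0"
    and X0_supp: "\<And>i j. i \<in> V \<Longrightarrow> j \<in> V \<Longrightarrow> X0 i j \<noteq> 0 \<Longrightarrow> {i, j} \<in> E"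
    by (auto simp: supported_def)
  \<comment> \<open>The missing edges receive weight \<open>e\<close>. Nonvanishing of finitely many
    sums survives for small \<open>e\<close> by continuity.\<close>
  define X where "X e i j = (if i \<noteq> j \<and> {i, j} \<in> E \<and> X0 i j = 0 then e else X0 i j)" for e i j
  have small: "\<forall>\<^sub>F e in at_right 0. e \<in> {0<..<radius}"
    by (rule eventually_at_right_real[OF radius_pos])
  have adm: "admissible (X e)" if "e \<in> {0<..<radius}" for e
    using X0 that by (auto simp: admissible_def X_def insert_commute)
  have X_lim: "((\<lambda>e. X e i j) \<longlongrightarrow> X0 i j) (at_right 0)" for i j
  proof (cases "i \<noteq> j \<and> {i, j} \<in> E \<and> X0 i j = 0")
    case False
    show ?thesis
      unfolding X_def if_not_P[OF False] by (rule tendsto_const)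
  qed (simp add: X_def tendsto_ident_at)
  have P_lim: "((\<lambda>e. eigenbasis (X e) i j) \<longlongrightarrow> eigenbasis X0 i j) (at_right 0)"
    if "i \<in> V" "j \<in> V" for i j
    using small adm
    by (intro tendsto_eigenbasis X0 X_lim that) (auto elim: eventually_mono)
  have "\<forall>\<^sub>F e in at_right 0. (\<Sum>j\<in>V. c j * eigenbasis (X e) w j) \<noteq> 0" if "c \<in> C" "w \<in> V" for c w
  proof (rule tendsto_imp_eventually_ne)
    show "((\<lambda>e. \<Sum>j\<in>V. c j * eigenbasis (X e) w j) \<longlongrightarrow> (\<Sum>j\<in>V. c j * eigenbasis X0 w j))
        (at_right 0)"
      by (intro tendsto_intros P_lim that)
    show "(\<Sum>j\<in>V. c j * eigenbasis X0 w j) \<noteq> 0"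
      using gen that by (auto simp: generic_def)
  qed
  then have "\<forall>\<^sub>F e in at_right 0. \<forall>c\<in>C. \<forall>w\<in>V. (\<Sum>j\<in>V. c j * eigenbasis (X e) w j) \<noteq> 0"
    using finite_V \<open>finite C\<close> by (intro eventually_ball_finite ballI)
  with small have "\<forall>\<^sub>F e in at_right 0. e \<in> {0<..<radius} \<and>
      (\<forall>c\<in>C. \<forall>w\<in>V. (\<Sum>j\<in>V. c j * eigenbasis (X e) w j) \<noteq> 0)"
    by (rule eventually_conj)
  then obtain e where e: "e \<in> {0<..<radius}"
    and ne: "\<And>c w. c \<in> C \<Longrightarrow> w \<in> V \<Longrightarrow> (\<Sum>j\<in>V. c j * eigenbasis (X e) w j) \<noteq> 0"
    using eventually_happens'[OF trivial_limit_at_right_real] by blast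
  show ?thesis
  proof (rule that[OF orthogonal_eigenbasis[OF adm[OF e]] _ ne])
    show "(\<lambda>i j. \<Sum>k\<in>V. l k * eigenbasis (X e) i k * eigenbasis (X e) j k) \<in> S_graph V E"
      unfolding S_graph_def
    proof (intro CollectI conjI ballI impI)
      fix i j assume ij: "i \<in> V" "j \<in> V"
      show "(\<Sum>k\<in>V. l k * eigenbasis (X e) i k * eigenbasis (X e) j k)
          = (\<Sum>k\<in>V. l k * eigenbasis (X e) j k * eigenbasis (X e) i k)"
        by (simp add: mult_ac)
      assume "i \<noteq> j"
      then show "(\<Sum>k\<in>V. l k * eigenbasis (X e) i k * eigenbasis (X e) j k) \<noteq> 0 \<longleftrightarrow> {i, j} \<in> E"
        unfolding eigenbasis_offdiag[OF adm[OF e] ij \<open>i \<noteq> j\<close>]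
        using e X0_supp[OF ij] by (auto simp: X_def)
    qed
  qed
qed

end

lemma generic_isospectral_matrix:
  assumes "sgraph V E" "connected_graph V E" "inj_on l V"
    and "finite C" "\<And>c. c \<in> C \<Longrightarrow> \<exists>j\<in>V. c j \<noteq> (0::real)"
  obtains P where "orthogonal_on V P"
    "(\<lambda>i j. \<Sum>k\<in>V. l k * P i k * P j k) \<in> S_graph V E"
    "\<And>c w. c \<in> C \<Longrightarrow> w \<in> V \<Longrightarrow> (\<Sum>j\<in>V. c j * P w j) \<noteq> 0"
proof -
  have fin: "finite V" using assms(1) by (simp add: sgraph_def)
  \<comment> \<open>The extra element 1 keeps the set nonempty when \<open>V\<close> has a single
    vertex.\<close>
  define D where "D = insert 1 ((\<lambda>(i, j). \<bar>l j - l i\<bar>) ` {(i, j) \<in> V \<times> V. i \<noteq> j})"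
  have "finite {(i, j) \<in> V \<times> V. i \<noteq> j}"
    by (rule finite_subset[of _ "V \<times> V"]) (use fin in auto)
  then have D: "finite D" "D \<noteq> {}" by (auto simp: D_def)
  interpret spectral_gap V l "Min D"
  proof
    show "Min D > 0"
      using D assms(3) by (auto simp: D_def inj_on_def)
    show "Min D \<le> \<bar>l j - l i\<bar>" if "i \<in> V" "j \<in> V" "i \<noteq> j" for i j
      using D that by (intro Min_le) (auto simp: D_def)
  qed (rule fin)
  show ?thesis
    using generic_connected[OF assms(1,2,4,5)] that by blast
qed

section \<open>Assembling the matrix of the partial join\<close>

lemma const_poly_sum: "[:\<Sum>x\<in>A. f x:] = (\<Sum>x\<in>A. [:f x:])"
proof (induction A rule: infinite_finite_induct)
  case (insert x A)
  then show ?case by (simp add: insert.IH[symmetric])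
qed simp_all

text \<open>With \<open>W\<close> read as a matrix of constant polynomials, the characteristic
  matrix of the conjugate is the conjugate of that of \<open>K\<close>, and the determinants of
  \<open>W\<close> and its transpose multiply to 1.\<close>

lemma charpoly_on_orthogonal_conj:
  assumes V: "finite V" and W: "orthogonal_on V W"
  shows "charpoly_on V (\<lambda>i j. \<Sum>a\<in>V. W i a * (\<Sum>b\<in>V. W j b * K a b)) = charpoly_on V K"
proof -
  define T where "T i j = (if i = j then [:0, 1:] else 0) - [:K i j:]" for i j
  define P where "P i j = [:W i j:]" for i j
  have conj: "(\<Sum>a\<in>V. P i a * (\<Sum>b\<in>V. T a b * P j b))
      = (if i = j then [:0, 1:] else 0) - [:\<Sum>a\<in>V. W i a * (\<Sum>b\<in>V. W j b * K a b):]"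
    if ij: "i \<in> V" "j \<in> V" for i j
  proof -
    have inner: "(\<Sum>b\<in>V. T a b * P j b) = [:0, 1:] * [:W j a:] - [:\<Sum>b\<in>V. W j b * K a b:]"
      if "a \<in> V" for a
    proof -
      have "(\<Sum>b\<in>V. T a b * P j b)
          = (\<Sum>b\<in>V. (if b = a then [:0, 1:] * [:W j a:] else 0) - [:W j b * K a b:])"
        by (rule sum.cong) (auto simp: T_def P_def algebra_simps)
      then show ?thesis
        using V that by (simp add: sum_subtractf const_poly_sum)
    qed
    have "(\<Sum>a\<in>V. P i a * (\<Sum>b\<in>V. T a b * P j b))
        = (\<Sum>a\<in>V. [:0, 1:] * [:W i a * W j a:] - [:W i a * (\<Sum>b\<in>V. W j b * K a b):])"
    proof (rule sum.cong[OF refl])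
      fix a assume "a \<in> V"
      show "P i a * (\<Sum>b\<in>V. T a b * P j b)
          = [:0, 1:] * [:W i a * W j a:] - [:W i a * (\<Sum>b\<in>V. W j b * K a b):]"
        unfolding inner[OF \<open>a \<in> V\<close>] unfolding P_def by (simp add: algebra_simps)
    qed
    also have "\<dots> = [:0, 1:] * [:\<Sum>a\<in>V. W i a * W j a:]
        - [:\<Sum>a\<in>V. W i a * (\<Sum>b\<in>V. W j b * K a b):]"
      by (simp only: sum_subtractf const_poly_sum sum_distrib_left)
    finally show ?thesis
      using orthogonal_on_rows[OF V W ij] by simp
  qed
  have "det_on V P * det_on V (\<lambda>i j. P j i) = det_on V (\<lambda>i j. \<Sum>k\<in>V. P i k * P j k)"
    by (rule det_on_mult[OF V, symmetric])
  also have "\<dots> = det_on V (\<lambda>i j. if i = j then 1 else 0)"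
  proof (rule det_on_cong)
    fix i j assume "i \<in> V" "j \<in> V"
    then have "[:\<Sum>k\<in>V. W i k * W j k:] = (if i = j then 1 else 0)"
      using orthogonal_on_rows[OF V W] by (simp add: one_pCons)
    moreover have "(\<Sum>k\<in>V. P i k * P j k) = [:\<Sum>k\<in>V. W i k * W j k:]"
      unfolding const_poly_sum by (simp add: P_def mult.commute)
    ultimately show "(\<Sum>k\<in>V. P i k * P j k) = (if i = j then 1 else 0)"
      by simp
  qed
  finally have det: "det_on V P * det_on V (\<lambda>i j. P j i) = 1"
    by (simp add: det_on_one[OF V])
  have "charpoly_on V (\<lambda>i j. \<Sum>a\<in>V. W i a * (\<Sum>b\<in>V. W j b * K a b))
      = det_on V (\<lambda>i j. \<Sum>a\<in>V. P i a * (\<Sum>b\<in>V. T a b * P j b))"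
    unfolding charpoly_on_def by (rule det_on_cong) (simp add: conj)
  also have "\<dots> = det_on V P * (det_on V T * det_on V (\<lambda>i j. P j i))"
    by (simp only: det_on_mult[OF V, of P "\<lambda>a j. \<Sum>b\<in>V. T a b * P j b"]
        det_on_mult[OF V, of T "\<lambda>b j. P j b"])
  also have "\<dots> = det_on V T"
    unfolding mult.left_commute[of _ "det_on V T"] det by simp
  finally show ?thesis
    by (simp add: charpoly_on_def T_def[abs_def])
qed

lemma charpoly_on_block_orthogonal_conj:
  assumes fin: "finite A" "finite B" and disj: "A \<inter> B = {}" and P: "orthogonal_on B P"
    and AA: "\<And>i j. i \<in> A \<Longrightarrow> j \<in> A \<Longrightarrow> N i j = K i j"
    and AB: "\<And>i j. i \<in> A \<Longrightarrow> j \<in> B \<Longrightarrow> N i j = (\<Sum>b\<in>B. P j b * K i b)"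
    and BA: "\<And>i j. i \<in> B \<Longrightarrow> j \<in> A \<Longrightarrow> N i j = (\<Sum>b\<in>B. P i b * K b j)"
    and BB: "\<And>i j. i \<in> B \<Longrightarrow> j \<in> B \<Longrightarrow> N i j = (\<Sum>a\<in>B. P i a * (\<Sum>b\<in>B. P j b * K a b))"
  shows "charpoly_on (A \<union> B) N = charpoly_on (A \<union> B) K"
proof -
  \<comment> \<open>The block diagonal matrix with the identity on \<open>A\<close> and
    \<open>P\<close> on \<open>B\<close>.\<close>
  define W where "W i j = (if i \<in> B \<and> j \<in> B then P i j else if i = j then 1 else 0)" for i j
  have row: "(\<Sum>a\<in>A \<union> B. W i a * g a) = (if i \<in> A then g i else \<Sum>a\<in>B. P i a * g a)"
    if "i \<in> A \<union> B" for i and g :: "'a \<Rightarrow> real"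
  proof (cases "i \<in> A")
    case True
    then have "(\<Sum>a\<in>A \<union> B. W i a * g a) = (\<Sum>a\<in>A \<union> B. if a = i then g i else 0)"
      using disj by (intro sum.cong) (auto simp: W_def)
    with True fin show ?thesis by simp
  next
    case False
    with that disj have "(\<Sum>a\<in>A. W i a * g a) = 0" "(\<Sum>a\<in>B. W i a * g a) = (\<Sum>a\<in>B. P i a * g a)"
      by (auto simp: W_def intro!: sum.neutral)
    with False fin disj show ?thesis
      by (simp add: sum.union_disjoint)
  qed
  have "orthogonal_on (A \<union> B) W"
    unfolding orthogonal_on_def
  proof (intro ballI)
    fix i j assume ij: "i \<in> A \<union> B" "j \<in> A \<union> B"
    have "(\<Sum>k\<in>A \<union> B. W k i * W k j) = (\<Sum>k\<in>A. W k i * W k j) + (\<Sum>k\<in>B. W k i * W k j)"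
      by (rule sum.union_disjoint[OF fin disj])
    also have "(\<Sum>k\<in>A. W k i * W k j) = (\<Sum>k\<in>A. if k = i then (if i = j then 1 else 0) else 0)"
      using disj by (intro sum.cong) (auto simp: W_def)
    also have "\<dots> = (if i \<in> A \<and> i = j then 1 else 0)"
      using fin by auto
    also have "(\<Sum>k\<in>B. W k i * W k j) = (if i \<in> B \<and> i = j then 1 else 0)"
    proof (cases "i \<in> B \<and> j \<in> B")
      case True
      then have "(\<Sum>k\<in>B. W k i * W k j) = (\<Sum>k\<in>B. P k i * P k j)"
        by (intro sum.cong) (auto simp: W_def)
      with True show ?thesis
        using orthogonal_on_columns[OF P] by simp
    next
      case False
      with ij disj have "\<forall>k\<in>B. W k i * W k j = 0"
        by (auto simp: W_def)
      then have "(\<Sum>k\<in>B. W k i * W k j) = 0"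
        by (rule sum.neutral)
      with False show ?thesis by auto
    qed
    finally show "(\<Sum>k\<in>A \<union> B. W k i * W k j) = (if i = j then 1 else 0)"
      using ij disj by auto
  qed
  from charpoly_on_orthogonal_conj[OF _ this, of K] fin
  have "charpoly_on (A \<union> B) (\<lambda>i j. \<Sum>a\<in>A \<union> B. W i a * (\<Sum>b\<in>A \<union> B. W j b * K a b))
      = charpoly_on (A \<union> B) K" by simp
  moreover have "charpoly_on (A \<union> B) N
      = charpoly_on (A \<union> B) (\<lambda>i j. \<Sum>a\<in>A \<union> B. W i a * (\<Sum>b\<in>A \<union> B. W j b * K a b))"
    by (rule charpoly_on_cong) (use AA AB BA BB disj in \<open>auto simp: row\<close>)
  ultimately show ?thesis by simp
qed

lemma proots_charpoly_on_diag:
  assumes "finite V"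
  shows "proots (charpoly_on V (\<lambda>i j. if i = j then l i else 0)) = image_mset l (mset_set V)"
proof -
  have "proots (\<Prod>i\<in>V. [:- l i, 1:]) = (\<Sum>i\<in>V. {#l i#})"
    by (subst proots_prod) simp_all
  also have "\<dots> = image_mset l (mset_set V)"
    using assms by (induction V rule: finite_induct) simp_all
  finally show ?thesis
    by (simp add: charpoly_on_diag[OF assms])
qed

section \<open>Edges of the partial join\<close>

lemma pjoin_edges_Inl: "{Inl i, Inl j} \<in> pjoin_edges E1 U W E2 \<longleftrightarrow> {i, j} \<in> E1"
proof -
  have "{Inl i, Inl j} \<in> image Inl ` E1 \<longleftrightarrow> {i, j} \<in> E1"
    using inj_image_mem_iff[of "image Inl" "{i, j}" E1] by (simp add: inj_def inj_image_eq_iff)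
  moreover have "{Inl i, Inl j} \<notin> image Inr ` E2"
    by blast
  moreover have "{Inl i, Inl j} \<notin> {{Inl u, Inr w} | u w. u \<in> U \<and> w \<in> W}"
    by blast
  ultimately show ?thesis
    by (simp only: pjoin_edges_def Un_iff simp_thms)
qed

lemma pjoin_edges_Inr: "{Inr i, Inr j} \<in> pjoin_edges E1 U W E2 \<longleftrightarrow> {i, j} \<in> E2"
proof -
  have "{Inr i, Inr j} \<in> image Inr ` E2 \<longleftrightarrow> {i, j} \<in> E2"
    using inj_image_mem_iff[of "image Inr" "{i, j}" E2] by (simp add: inj_def inj_image_eq_iff)
  moreover have "{Inr i, Inr j} \<notin> image Inl ` E1"
    by blast
  moreover have "{Inr i, Inr j} \<notin> {{Inl u, Inr w} | u w. u \<in> U \<and> w \<in> W}"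
    by blast
  ultimately show ?thesis
    by (simp only: pjoin_edges_def Un_iff simp_thms)
qed

lemma pjoin_edges_mixed: "{Inl i, Inr w} \<in> pjoin_edges E1 U W E2 \<longleftrightarrow> i \<in> U \<and> w \<in> W"
proof -
  have "{Inl i, Inr w} \<notin> image Inl ` E1"
    by blast
  moreover have "{Inl i, Inr w} \<notin> image Inr ` E2"
    by blast
  moreover have "{Inl i, Inr w} \<in> {{Inl u, Inr v} | u v. u \<in> U \<and> v \<in> W} \<longleftrightarrow> i \<in> U \<and> w \<in> W"
    by (auto simp: doubleton_eq_iff)
  ultimately show ?thesis
    by (simp only: pjoin_edges_def Un_iff simp_thms)
qed

theorem theorem3p7:
  fixes V V1 V2 :: "'a set" and E :: "'a set set"
    and VH :: "'b set" and EH :: "'b set set"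
    and M :: "'a \<Rightarrow> 'a \<Rightarrow> real" and mus :: "real list"
  assumes "sgraph V E"
    and "V1 \<union> V2 = V" and "V1 \<inter> V2 = {}" and "V2 \<noteq> {}"
    and "X = vertex_boundary V E V2"
    and "sgraph VH EH" and "connected_graph VH EH"
    and "card VH \<ge> card V2"
    and "V' = pjoin_vertices V1 VH"
    and "E' = pjoin_edges (induced_edges E V1) X VH EH"
    and "M \<in> S_graph V E"
    and "\<forall>x. count (spectrum_on V2 M) x \<le> 1"
    and "length mus = card VH - card V2" and "distinct mus"
    and "\<forall>m\<in>set mus. m \<notin># spectrum_on V2 M"
  shows "\<exists>N. N \<in> S_graph V' E' \<and> spectrum_on V' N = spectrum_on V M + mset mus"
proof -
  note disj = \<open>V1 \<inter> V2 = {}\<close>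
  have "finite V" and finH: "finite VH"
    using \<open>sgraph V E\<close> \<open>sgraph VH EH\<close> by (auto simp: sgraph_def)
  then have fin: "finite V1" "finite V2"
    using \<open>V1 \<union> V2 = V\<close> by auto
  have sym: "M i j = M j i" if "i \<in> V" "j \<in> V" for i j
    using \<open>M \<in> S_graph V E\<close> that by (auto simp: S_graph_def)
  have sub: "V1 \<subseteq> V" "V2 \<subseteq> V" using \<open>V1 \<union> V2 = V\<close> by auto
  have edge: "M i j \<noteq> 0 \<longleftrightarrow> {i, j} \<in> E" if "i \<in> V" "j \<in> V" "i \<noteq> j" for i j
    using \<open>M \<in> S_graph V E\<close> that by (auto simp: S_graph_def)
  define L where "L = set_mset (spectrum_on V2 M)"
  have cardL: "card L = card V2"
    unfolding L_def by (rule card_simple_spectrum) (use fin sym sub assms(12) in auto)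
  have sym2: "M i j = M j i" if "i \<in> V2" "j \<in> V2" for i j
    using sym sub that by blast
  obtain q where q: "\<forall>x\<in>L. (\<forall>i\<in>V2. (\<Sum>j\<in>V2. M i j * q x j) = x * q x i) \<and>
      (\<forall>y\<in>L. (\<Sum>i\<in>V2. q x i * q y i) = (if x = y then 1 else 0))"
    unfolding L_def using orthonormal_eigenvectors_on[of V2 M, OF fin(2) sym2] by (rule exE)
  have q_eig: "(\<Sum>j\<in>V2. M i j * q x j) = x * q x i" if "x \<in> L" "i \<in> V2" for x i
    using q that by blast
  have q_orth: "(\<Sum>i\<in>V2. q x i * q y i) = (if x = y then 1 else 0)" if "x \<in> L" "y \<in> L" for x y
    using q that by blast
  have L_mus: "L \<inter> set mus = {}"
    using assms(15) by (auto simp: L_def)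
  have "card (L \<union> set mus) = card VH"
    using cardL L_mus \<open>distinct mus\<close> assms(8,13)
    by (subst card_Un_disjoint) (auto simp: L_def distinct_card)
  \<comment> \<open>Each vertex of \<open>H\<close> is labelled with one target eigenvalue;
    \<open>J\<close> below collects those labelled by eigenvalues of \<open>M[V2]\<close>.\<close>
  then obtain l where l: "bij_betw l VH (L \<union> set mus)"
    using finite_same_card_bij[OF finH, of "L \<union> set mus"] by (auto simp: L_def)
  then have inj: "inj_on l VH" and im: "l ` VH = L \<union> set mus"
    by (auto simp: bij_betw_def)
  define J where "J = {j \<in> VH. l j \<in> L}"
  have J_sub: "J \<subseteq> VH" by (auto simp: J_def)
  have lJ: "bij_betw l J L"
    using inj im by (auto simp: bij_betw_def J_def inj_on_def)
  have lJ': "bij_betw l (VH - J) (set mus)"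
    unfolding bij_betw_def
  proof
    show "inj_on l (VH - J)" using inj by (rule inj_on_subset) auto
    have "l ` (VH - J) = l ` VH - l ` J"
      by (rule inj_on_image_set_diff[OF inj]) (use J_sub in auto)
    then show "l ` (VH - J) = set mus"
      using im lJ L_mus by (auto simp: bij_betw_def)
  qed
  have finJ: "finite J" using J_sub finH by (rule finite_subset)
  \<comment> \<open>Any bijection serves: it only says which eigenvalue belongs to which column of
    \<open>Q\<close>.\<close>
  obtain f where f: "bij_betw f V2 J"
    using finite_same_card_bij[OF fin(2) finJ] cardL bij_betw_same_card[OF lJ] by auto
  have fJ: "f w \<in> J" if "w \<in> V2" for w
    using f that by (auto dest: bij_betwE)
  have fL: "l (f w) \<in> L" if "w \<in> V2" for w
    using fJ[OF that] by (simp add: J_def)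
  define Q where "Q v w = q (l (f w)) v" for v w
  have Q: "orthogonal_on V2 Q"
    unfolding orthogonal_on_def
  proof (intro ballI)
    fix v w assume vw: "v \<in> V2" "w \<in> V2"
    have "inj_on (\<lambda>w. l (f w)) V2"
      using comp_inj_on[of f V2 l] f lJ by (auto simp: bij_betw_def comp_def)
    then have "l (f v) = l (f w) \<longleftrightarrow> v = w"
      using vw by (auto simp: inj_on_def)
    then show "(\<Sum>k\<in>V2. Q k v * Q k w) = (if v = w then 1 else 0)"
      unfolding Q_def using q_orth[OF fL[OF vw(1)] fL[OF vw(2)]] by simp
  qed
  \<comment> \<open>For \<open>v\<close> in \<open>V1\<close> this is row \<open>v\<close> of
    \<open>C\<close>, with columns moved to \<open>J\<close> and padded by zeros. Rows for
    \<open>v\<close> in \<open>V2\<close> make sense too and later serve to recover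
    \<open>M[V2]\<close>.\<close>
  define c where "c v j = (if j \<in> J then \<Sum>w\<in>V2. M v w * q (l j) w else 0)" for v j
  have c_f: "(\<Sum>b\<in>V2. Q w b * c v (f b)) = M v w" if "w \<in> V2" for v w
  proof -
    have "(\<Sum>b\<in>V2. Q w b * c v (f b)) = (\<Sum>b\<in>V2. \<Sum>m\<in>V2. M v m * (Q m b * Q w b))"
      using fJ by (intro sum.cong) (auto simp: c_def Q_def sum_distrib_left mult_ac)
    also have "\<dots> = (\<Sum>m\<in>V2. M v m * (\<Sum>b\<in>V2. Q m b * Q w b))"
      by (subst sum.swap) (simp add: sum_distrib_left)
    also have "\<dots> = (\<Sum>m\<in>V2. if m = w then M v w else 0)"
      using orthogonal_on_rows[OF fin(2) Q] that by (intro sum.cong) auto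
    finally show ?thesis
      using fin that by simp
  qed
  \<comment> \<open>A zero row would make \<open>M v w\<close> vanish for every \<open>w\<close> in
    \<open>V2\<close>, but a boundary vertex has a neighbour there.\<close>
  have c_ne: "\<exists>j\<in>VH. c' j \<noteq> 0" if "c' \<in> c ` X" for c'
  proof (rule ccontr)
    assume zero: "\<not> (\<exists>j\<in>VH. c' j \<noteq> 0)"
    from that obtain v where v: "v \<in> X" "c' = c v" by blast
    then obtain w where w: "w \<in> V2" "{v, w} \<in> E" and vV: "v \<in> V" "v \<notin> V2"
      using assms(5) by (auto simp: vertex_boundary_def)
    have "M v w = (\<Sum>b\<in>V2. Q w b * c v (f b))"
      by (rule c_f[OF w(1), symmetric])
    also have "\<dots> = 0"
      using zero fJ J_sub v(2) by (intro sum.neutral) auto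
    finally show False
      using edge[of v w] vV w sub by auto
  qed
  have c_0: "c v j = 0" if "v \<in> V1" "v \<notin> X" for v j
  proof -
    have "M v w = 0" if "w \<in> V2" for w
      using edge[of v w] that \<open>v \<in> V1\<close> \<open>v \<notin> X\<close> sub disj assms(5)
      by (auto simp: vertex_boundary_def)
    then show ?thesis by (simp add: c_def)
  qed
  have X_sub: "X \<subseteq> V1"
    using assms(2,5) by (auto simp: vertex_boundary_def)
  then have finX: "finite (c ` X)"
    using fin(1) by (auto intro: finite_subset)
  obtain P where P: "orthogonal_on VH P"
    and P_S: "(\<lambda>i j. \<Sum>k\<in>VH. l k * P i k * P j k) \<in> S_graph VH EH"
    and P_ne: "\<And>c' w. c' \<in> c ` X \<Longrightarrow> w \<in> VH \<Longrightarrow> (\<Sum>j\<in>VH. c' j * P w j) \<noteq> 0"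
    using generic_isospectral_matrix[OF assms(6,7) inj finX c_ne] by blast
  \<comment> \<open>\<open>K\<close> has the blocks \<open>M[V1]\<close>, the padded
    \<open>C\<close>, its transpose and the diagonal matrix of \<open>l\<close>; \<open>N\<close> is
    \<open>K\<close> with its second block conjugated by \<open>P\<close>.\<close>
  define K :: "'a + 'b \<Rightarrow> 'a + 'b \<Rightarrow> real" where
    "K x y = (case x of
        Inl i \<Rightarrow> (case y of Inl j \<Rightarrow> M i j | Inr j \<Rightarrow> c i j)
      | Inr i \<Rightarrow> (case y of Inl j \<Rightarrow> c j i | Inr j \<Rightarrow> if i = j then l i else 0))" for x y
  define N :: "'a + 'b \<Rightarrow> 'a + 'b \<Rightarrow> real" where
    "N x y = (case x of
        Inl i \<Rightarrow> (case y of Inl j \<Rightarrow> M i j | Inr w \<Rightarrow> \<Sum>k\<in>VH. c i k * P w k)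
      | Inr v \<Rightarrow> (case y of Inl j \<Rightarrow> \<Sum>k\<in>VH. c j k * P v k
          | Inr w \<Rightarrow> \<Sum>k\<in>VH. l k * P v k * P w k))" for x y
  have V': "V' = Inl ` V1 \<union> Inr ` VH"
    using assms(9) by (simp add: pjoin_vertices_def)

  have "N \<in> S_graph V' E'"
    unfolding S_graph_def
  proof (intro CollectI conjI ballI impI)
    fix x y assume "x \<in> V'" "y \<in> V'"
    then show "N x y = N y x"
      using sym[OF subsetD[OF sub(1)] subsetD[OF sub(1)]] by (auto simp: V' N_def mult_ac)
  next
    fix x y assume xy: "x \<in> V'" "y \<in> V'" "x \<noteq> y"
    have mixed: "(\<Sum>k\<in>VH. c i k * P w k) \<noteq> 0 \<longleftrightarrow> i \<in> X" if "i \<in> V1" "w \<in> VH" for i w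
      using P_ne[of "c i" w] c_0[OF that(1)] that by (cases "i \<in> X") auto
    consider i j where "x = Inl i" "y = Inl j" "i \<in> V1" "j \<in> V1"
      | i w where "x = Inl i" "y = Inr w" "i \<in> V1" "w \<in> VH"
      | i w where "x = Inr w" "y = Inl i" "i \<in> V1" "w \<in> VH"
      | v w where "x = Inr v" "y = Inr w" "v \<in> VH" "w \<in> VH"
      using xy(1,2) unfolding V' by blast
    then show "N x y \<noteq> 0 \<longleftrightarrow> {x, y} \<in> E'"
    proof cases
      case 1
      then show ?thesis
        using edge[of i j] sub xy(3) by (auto simp: N_def assms(10) pjoin_edges_Inl induced_edges_def)
    next
      case 4
      then show ?thesis
        using P_S xy(3) by (auto simp: N_def S_graph_def assms(10) pjoin_edges_Inr)
    qed (simp_all add: N_def mixed assms(10) pjoin_edges_mixed insert_commute[of "Inr _" "Inl _"])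
  qed

  moreover have "spectrum_on V' N = spectrum_on V M + mset mus"
  proof -
    define g :: "'a \<Rightarrow> 'a + 'b" where "g v = (if v \<in> V1 then Inl v else Inr (f v))" for v
    have "bij_betw g (V1 \<union> V2) (Inl ` V1 \<union> Inr ` J)"
    proof (rule bij_betw_combine)
      show "bij_betw g V1 (Inl ` V1)"
        by (auto simp: bij_betw_def inj_on_def g_def)
      show "bij_betw g V2 (Inr ` J)"
        using f disj by (force simp: bij_betw_def inj_on_def g_def)
    qed auto
    then have g: "bij_betw g V (Inl ` V1 \<union> Inr ` J)"
      using assms(2) by simp
    \<comment> \<open>The padded columns are zero, so the part of \<open>K\<close> outside
      \<open>J\<close> splits off as a diagonal block carrying the values in
      \<open>mus\<close>.\<close>
    have split: "(Inl ` V1 \<union> Inr ` VH :: ('a + 'b) set) = (Inl ` V1 \<union> Inr ` J) \<union> Inr ` (VH - J)"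
      using J_sub by auto
    have "charpoly_on (Inl ` V1 \<union> Inr ` VH) N = charpoly_on (Inl ` V1 \<union> Inr ` VH) K"
    proof (rule charpoly_on_block_orthogonal_conj[where P = "\<lambda>x y. P (projr x) (projr y)"])
      show "orthogonal_on (Inr ` VH) (\<lambda>x y. P (projr x) (projr y))"
        using P by (auto simp: orthogonal_on_def sum.reindex)
      fix x y :: "'a + 'b" assume "x \<in> Inr ` VH" "y \<in> Inr ` VH"
      then obtain v w where vw: "x = Inr v" "y = Inr w" "v \<in> VH" "w \<in> VH" by blast
      have "(\<Sum>k\<in>VH. l k * P v k * P w k)
          = (\<Sum>a\<in>VH. P v a * (\<Sum>b\<in>VH. P w b * (if a = b then l a else 0)))"
        using finH by (intro sum.cong) (auto simp: if_distrib mult_ac cong: if_cong)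
      then show "N x y = (\<Sum>a\<in>Inr ` VH. P (projr x) (projr a) *
          (\<Sum>b\<in>Inr ` VH. P (projr y) (projr b) * K a b))"
        by (simp add: vw N_def K_def sum.reindex)
    qed (use fin finH in \<open>auto simp: N_def K_def sum.reindex mult.commute\<close>)
    also have "charpoly_on (Inl ` V1 \<union> Inr ` VH) K
        = charpoly_on (Inl ` V1 \<union> Inr ` J) K * charpoly_on (Inr ` (VH - J)) K"
      unfolding split by (rule charpoly_on_block) (use fin finH finJ in \<open>auto simp: K_def c_def\<close>)
    also have "charpoly_on (Inl ` V1 \<union> Inr ` J) K = charpoly_on V (\<lambda>i j. K (g i) (g j))"
      by (rule charpoly_on_reindex[OF g \<open>finite V\<close>])
    also have "\<dots> = charpoly_on V M"
      unfolding \<open>V1 \<union> V2 = V\<close>[symmetric]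
    \<comment> \<open>Read backwards: \<open>M\<close> itself arises from the remaining block of
      \<open>K\<close> by conjugation with \<open>Q\<close>.\<close>
    proof (rule charpoly_on_block_orthogonal_conj[symmetric, OF fin disj Q])
      have g1: "g i = Inl i" if "i \<in> V1" for i using that by (simp add: g_def)
      have g2: "g i = Inr (f i)" if "i \<in> V2" for i using that disj by (auto simp: g_def)
      show "M i j = K (g i) (g j)" if "i \<in> V1" "j \<in> V1" for i j
        using that by (simp add: g1 K_def)
      show "M i j = (\<Sum>b\<in>V2. Q j b * K (g i) (g b))" if "i \<in> V1" "j \<in> V2" for i j
        using c_f[OF that(2), of i] that by (simp add: g1 g2 K_def)
      show "M i j = (\<Sum>b\<in>V2. Q i b * K (g b) (g j))" if "i \<in> V2" "j \<in> V1" for i j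
        using c_f[OF that(1), of j] that sym[of i j] sub by (auto simp: g1 g2 K_def)
      fix i j assume ij: "i \<in> V2" "j \<in> V2"
      have inj_f: "f a = f b \<longleftrightarrow> a = b" if "a \<in> V2" "b \<in> V2" for a b
        using f that by (auto simp: bij_betw_def inj_on_def)
      have "(\<Sum>a\<in>V2. Q i a * (\<Sum>b\<in>V2. Q j b * K (g a) (g b)))
          = (\<Sum>a\<in>V2. Q i a * (\<Sum>b\<in>V2. if b = a then Q j a * l (f a) else 0))"
        by (intro sum.cong refl arg_cong2[where f = "(*)"]) (auto simp: g2 K_def inj_f)
      also have "\<dots> = (\<Sum>a\<in>V2. Q j a * (l (f a) * Q i a))"
        using fin by (simp add: mult_ac)
      \<comment> \<open>The eigenvalue equation identifies \<open>l (f a) * Q i a\<close> with row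
        \<open>i\<close> of \<open>M[V2]\<close> applied to column \<open>a\<close> of
        \<open>Q\<close>, so \<open>c_f\<close> applies to rows in \<open>V2\<close> as
        well.\<close>
      also have "\<dots> = (\<Sum>a\<in>V2. Q j a * c i (f a))"
        using q_eig[OF fL ij(1)] fJ by (intro sum.cong) (auto simp: c_def Q_def)
      also have "\<dots> = M i j"
        by (rule c_f[OF ij(2)])
      finally show "M i j = (\<Sum>a\<in>V2. Q i a * (\<Sum>b\<in>V2. Q j b * K (g a) (g b)))" ..
    qed
    also have "charpoly_on (Inr ` (VH - J)) K
        = charpoly_on (VH - J) (\<lambda>i j. if i = j then l i else 0)"
      using charpoly_on_reindex[of Inr "VH - J" "Inr ` (VH - J)" K] finH
      by (simp add: bij_betw_def K_def)
    finally have "charpoly_on V' N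
        = charpoly_on V M * charpoly_on (VH - J) (\<lambda>i j. if i = j then l i else 0)"
      by (simp add: V')
    then have "spectrum_on V' N = spectrum_on V M + image_mset l (mset_set (VH - J))"
      using finH \<open>finite V\<close>
      by (simp add: spectrum_on_def proots_mult charpoly_on_nonzero proots_charpoly_on_diag)
    also have "image_mset l (mset_set (VH - J)) = mset_set (set mus)"
      using lJ' by (metis bij_betw_def image_mset_mset_set)
    also have "\<dots> = mset mus"
      using \<open>distinct mus\<close> by (rule mset_set_set)
    finally show ?thesis .
  qed
  ultimately show ?thesis by blast
qed

end
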